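(* Let $A\in\mathbb{R}^{n\times n}$ be symmetric positive definite (SPD), let $M\in\mathbb{R}^{n\times n}$ be nonsingular with $M+M^{T}-A$ SPD, let $P\in\mathbb{R}^{n\times n_{\rm c}}$ ($1\le n_{\rm c}<n$) have full column rank, and let $B_{\rm c}\in\mathbb{R}^{n_{\rm c}\times n_{\rm c}}$ be SPD. With $A_{\rm c}$, $\widetilde{M}$, $\varPi_{\widetilde{M}}$, $K_{\rm TG}$, $E_{\rm ITG}$, $d_1$, $d_2$ as defined in the context, the energy norm $\|E_{\rm ITG}\|_{A}$ satisfies the following estimates. (i) If $d_{2}\leq 1$, then $\mathscr{L}_{1}\leq\|E_{\rm ITG}\|_{A}\leq\mathscr{U}_{1}$, where $$\mathscr{L}_{1}=1-\frac{1}{\max\big\{K_{\rm TG},\,\lambda_{\max}(A^{-1}\widetilde{M})-d_{2}\lambda_{\max}(A^{-1}\widetilde{M}\varPi_{\widetilde{M}})+d_{2}\big\}},$$ $$\mathscr{U}_{1}=1-\frac{1}{d_{1}K_{\rm TG}+(1-d_{1})\lambda_{\max}(A^{-1}\widetilde{M})}.$$ (ii) If $d_{1}\leq 1<d_{2}<\dfrac{\lambda_{\max}(A^{-1}\widetilde{M}\varPi_{\widetilde{M}})}{\lambda_{\max}(A^{-1}\widetilde{M}\varPi_{\widetilde{M}})-1}$, then $\mathscr{L}_{2}\leq\|E_{\rm ITG}\|_{A}\leq\max\{\mathscr{U}_{1},\,\mathscr{U}_{2}\}$, where $\mathscr{U}_1$ is given by the formula in (i) and $$\mathscr{L}_{2}=1-\frac{1}{\max\big\{\lambda_{\min}(A^{-1}\widetilde{M}),\,d_{2}K_{\rm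 TG}+(1-d_{2})\lambda_{\max}(A^{-1}\widetilde{M})\big\}},$$ $$\mathscr{U}_{2}=\frac{1}{(1-d_{2})\lambda_{\max}(A^{-1}\widetilde{M}\varPi_{\widetilde{M}})+d_{2}}-1.$$ (iii) If $1<d_{1}\leq d_{2}<\dfrac{\lambda_{\max}(A^{-1}\widetilde{M}\varPi_{\widetilde{M}})}{\lambda_{\max}(A^{-1}\widetilde{M}\varPi_{\widetilde{M}})-1}$, then $\max\{\mathscr{L}_{2},\,\mathscr{L}_{3}\}\leq\|E_{\rm ITG}\|_{A}\leq\mathscr{U}_{3}$, where $\mathscr{L}_2$ is given by the formula in (ii) and $$\mathscr{L}_{3}=\frac{1}{\min\big\{\lambda_{\max}(A^{-1}\widetilde{M})-d_{1}\lambda_{\max}(A^{-1}\widetilde{M}\varPi_{\widetilde{M}}),\,(1-d_{1})\lambda_{\min}(A^{-1}\widetilde{M})\big\}+d_{1}}-1,$$ $$\mathscr{U}_{3}=\max\bigg\{1-\frac{1}{K_{\rm TG}},\,\frac{1}{(1-d_{2})\lambda_{\max}(A^{-1}\widetilde{M}\varPi_{\widetilde{M}})+d_{2}}-1\bigg\}.$$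
   Context: $\lambda_{\min}(\cdot)$, $\lambda_{\max}(\cdot)$ denote the smallest and largest eigenvalues of a matrix (all matrices to which they are applied here have real spectrum). For SPD $A$, $\|\mathbf{v}\|_A=\langle A\mathbf{v},\mathbf{v}\rangle^{1/2}$ for vectors, and $\|B\|_A=\max_{\mathbf{v}\neq 0}\|B\mathbf{v}\|_A/\|\mathbf{v}\|_A$ for $B\in\mathbb{R}^{n\times n}$; $\|\cdot\|_{\widetilde M}$ is defined analogously. $M^{-T}=(M^{-1})^T$. Definitions: $A_{\rm c}:=P^{T}AP$ (the Galerkin coarse-grid matrix); $\widetilde{M}:=M^{T}(M+M^{T}-A)^{-1}M$ (which is SPD); $\varPi_{\widetilde{M}}:=P(P^{T}\widetilde{M}P)^{-1}P^{T}\widetilde{M}$; $$K_{\rm TG}:=\max_{\mathbf{v}\in\mathbb{R}^{n}\setminus\{0\}}\frac{\|(I-\varPi_{\widetilde{M}})\mathbf{v}\|_{\widetilde{M}}^{2}}{\|\mathbf{v}\|_{A}^{2}};$$ $E_{\rm ITG}:=(I-M^{-T}A)(I-PB_{\rm c}^{-1}P^{T}A)(I-M^{-1}A)$ (the error propagation matrix of the inexact two-grid method with coarse-grid matrix $B_{\rm c}$); $$d_{1}:=\frac{1}{1+\lambda_{\max}\big((P^{T}\widetilde{M}P)^{-1}(B_{\rm c}-A_{\rm c})\big)},\qquad d_{2}:=\frac{1}{1+\lambda_{\min}\big((P^{T}\widetilde{M}P)^{-1}(B_{\rm c}-A_{\rm c})\big)}.$$ Convention: a quotient $\frac{x}{x-1}$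 with $x=1$ (which can occur for $x=\lambda_{\max}(A^{-1}\widetilde{M}\varPi_{\widetilde{M}})\ge 1$) is read as $+\infty$. *)

theory Defs
  imports "HOL-Analysis.Analysis" "HOL-Library.Extended_Real"
begin

definition spd :: "real^'n^'n \<Rightarrow> bool" where
  "spd A \<longleftrightarrow> transpose A = A \<and> (\<forall>v. v \<noteq> 0 \<longrightarrow> (A *v v) \<bullet> v > 0)"

(* Only real eigenvalues are collected.  The matrices to which lambda_min and lambda_max
   are applied below are products of an SPD and a symmetric matrix, so their whole
   spectrum is real (and nonempty and finite, as Min and Max require). *)
definition eigenvalues :: "real^'n^'n \<Rightarrow> real set" where
  "eigenvalues X = {l. \<exists>v. v \<noteq> 0 \<and> X *v v = l *\<^sub>R v}"

definition lambda_min :: "real^'n^'n \<Rightarrow> real" where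
  "lambda_min X = Min (eigenvalues X)"

definition lambda_max :: "real^'n^'n \<Rightarrow> real" where
  "lambda_max X = Max (eigenvalues X)"

definition vnorm :: "real^'n^'n \<Rightarrow> real^'n \<Rightarrow> real" where
  "vnorm A v = sqrt ((A *v v) \<bullet> v)"

(* In mnorm and K_TG the mathematical maximum over all nonzero vectors is written as a
   supremum, since Max is for finite sets; for SPD A the quotients are continuous and
   homogeneous of degree 0, so the supremum is finite and attained. *)
definition mnorm :: "real^'n^'n \<Rightarrow> real^'n^'n \<Rightarrow> real" where
  "mnorm A X = (SUP v\<in>UNIV - {0}. vnorm A (X *v v) / vnorm A v)"

definition coarse :: "real^'n^'n \<Rightarrow> real^'c^'n \<Rightarrow> real^'c^'c" where
  "coarse A P = transpose P ** A ** P"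

definition Mtilde :: "real^'n^'n \<Rightarrow> real^'n^'n \<Rightarrow> real^'n^'n" where
  "Mtilde A M = transpose M ** matrix_inv (M + transpose M - A) ** M"

definition Pi_proj :: "real^'n^'n \<Rightarrow> real^'c^'n \<Rightarrow> real^'n^'n" where
  "Pi_proj X P = P ** matrix_inv (transpose P ** X ** P) ** transpose P ** X"

definition K_TG :: "real^'n^'n \<Rightarrow> real^'n^'n \<Rightarrow> real^'c^'n \<Rightarrow> real" where
  "K_TG A M P =
     (SUP v\<in>UNIV - {0}.
        (vnorm (Mtilde A M) ((mat 1 - Pi_proj (Mtilde A M) P) *v v))\<^sup>2 / (vnorm A v)\<^sup>2)"

definition E_ITG ::
    "real^'n^'n \<Rightarrow> real^'n^'n \<Rightarrow> real^'c^'n \<Rightarrow> real^'c^'c \<Rightarrow> real^'n^'n" where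
  "E_ITG A M P Bc =
     (mat 1 - transpose (matrix_inv M) ** A)
     ** (mat 1 - P ** matrix_inv Bc ** transpose P ** A)
     ** (mat 1 - matrix_inv M ** A)"

definition d1 :: "real^'n^'n \<Rightarrow> real^'n^'n \<Rightarrow> real^'c^'n \<Rightarrow> real^'c^'c \<Rightarrow> real" where
  "d1 A M P Bc =
     1 / (1 + lambda_max (matrix_inv (transpose P ** Mtilde A M ** P) ** (Bc - coarse A P)))"

definition d2 :: "real^'n^'n \<Rightarrow> real^'n^'n \<Rightarrow> real^'c^'n \<Rightarrow> real^'c^'c \<Rightarrow> real" where
  "d2 A M P Bc =
     1 / (1 + lambda_min (matrix_inv (transpose P ** Mtilde A M ** P) ** (Bc - coarse A P)))"

(* x/(x-1), read as +infinity for x = 1 *)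
definition quot_pred :: "real \<Rightarrow> ereal" where
  "quot_pred x = (if x = 1 then \<infinity> else ereal (x / (x - 1)))"

end

theory Submission
  imports Defs
begin

text \<open>
Write \<open>N\<close> for the matrix \<open>Mtilde A M\<close>, \<open>R\<close> for the \<open>N\<close>-orthogonal projection onto the range of \<open>P\<close>,
\<open>C = A\<^sup>-\<^sup>1 N - I\<close>, and \<open>Q = P (P\<^sup>T N P + Bc - A\<^sub>c)\<^sup>-\<^sup>1 P\<^sup>T N\<close>. The error propagation matrix has the same
nonzero eigenvalues as \<open>F = (I - N\<^sup>-\<^sup>1 A)(I - P Bc\<^sup>-\<^sup>1 P\<^sup>T A)\<close>, and the Woodbury formula gives
\<open>C (I - Q) = F (I - F)\<^sup>-\<^sup>1\<close>. Hence its nonzero eigenvalues are \<open>\<nu> / (1 + \<nu>)\<close> for the nonzero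
eigenvalues \<open>\<nu>\<close> of \<open>C (I - Q)\<close>. Since \<open>C\<close> is positive semidefinite in the \<open>N\<close>-inner product, the
extremal \<open>\<nu>\<close> are extrema of the quotient \<open>\<langle>(I - Q) C x, C x\<rangle> / \<langle>C x, x\<rangle>\<close>, which is monotone in \<open>Q\<close>;
and \<open>d\<^sub>1 R \<le> Q \<le> d\<^sub>2 R\<close>. For an \<open>N\<close>-orthogonal projection \<open>S\<close> (here \<open>I\<close>, \<open>R\<close> and \<open>I - R\<close>) the maximum
of \<open>\<langle>S C x, C x\<rangle> / \<langle>C x, x\<rangle>\<close> is \<open>\<lambda>\<^sub>m\<^sub>a\<^sub>x(A\<^sup>-\<^sup>1 N S) - 1\<close>, which yields all the bounds.
\<close>

section \<open>Symmetric matrices and pencils\<close>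

declare transpose_matrix_vector [simp del]

lemma matrix_inv_inverse:
  fixes X :: "real^'n^'n"
  assumes "invertible X"
  shows "X ** matrix_inv X = mat 1" "matrix_inv X ** X = mat 1"
  using someI_ex[OF assms[unfolded invertible_def]] by (auto simp: matrix_inv_def)

lemma matrix_inv_cancel:
  fixes X :: "real^'n^'n"
  assumes "invertible X"
  shows "X *v (matrix_inv X *v x) = x" "matrix_inv X *v (X *v x) = x"
  using matrix_inv_inverse[OF assms] by (simp_all add: matrix_vector_mul_assoc)

lemma inner_matrix_transpose:
  fixes X :: "real^'m^'n"
  shows "(X *v x) \<bullet> y = x \<bullet> (transpose X *v y)"
  by (metis dot_lmul_matrix inner_commute transpose_matrix_vector)

lemma symmetric_inner:
  fixes S :: "real^'n^'n"
  assumes "transpose S = S"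
  shows "(S *v x) \<bullet> y = (S *v y) \<bullet> x"
  by (metis assms inner_commute inner_matrix_transpose)

lemma symmetricI:
  fixes S :: "real^'n^'n"
  assumes "\<And>x y. (S *v x) \<bullet> y = (S *v y) \<bullet> x"
  shows "transpose S = S"
proof -
  have "transpose S *v x = S *v x" for x
  proof (rule vector_eq_ldot[THEN iffD1], intro allI)
    fix y show "y \<bullet> (transpose S *v x) = y \<bullet> (S *v x)"
      by (metis assms inner_commute inner_matrix_transpose)
  qed
  then show ?thesis by (simp add: matrix_eq)
qed

lemma matrix_vector_mult_minus:
  fixes S :: "real^'m^'n"
  shows "(- S) *v x = - (S *v x)"
  using matrix_vector_mult_diff_rdistrib[of 0 S x] by simp

lemma transpose_add: "transpose (X + Y) = transpose X + transpose (Y :: real^'m^'n)"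
  by (simp add: transpose_def vec_eq_iff)

lemma transpose_diff: "transpose (X - Y) = transpose X - transpose (Y :: real^'m^'n)"
  by (simp add: transpose_def vec_eq_iff)

lemma transpose_uminus: "transpose (- Y) = - transpose (Y :: real^'m^'n)"
  by (simp add: transpose_def vec_eq_iff)

section \<open>Cauchy-Schwarz for semidefinite forms\<close>

lemma quadratic_nonneg_imp_discriminant:
  fixes a b c :: real
  assumes "\<And>t. a + 2 * t * b + t\<^sup>2 * c \<ge> 0"
  shows "b\<^sup>2 \<le> a * c"
proof (cases "c = 0")
  case True
  \<comment> \<open>For b \<noteq> 0 this value of t makes the affine function equal to -1.\<close>
  have "a + 2 * (- (a + 1) / (2 * b)) * b \<ge> 0" using assms[of "- (a + 1) / (2 * b)"] True by simp
  then have "b = 0" by (cases "b = 0") (auto simp: field_simps)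
  then show ?thesis using True by simp
next
  case False
  have "c \<ge> 0"
  proof (rule ccontr)
    assume "\<not> c \<ge> 0"
    \<comment> \<open>Chosen so large that the negative quadratic term outweighs the other
      two.\<close>
    define t where "t = (\<bar>a\<bar> + 1 + 2 * \<bar>b\<bar>) / (- c) + 1"
    have t: "t \<ge> 1" "t * (-c) \<ge> \<bar>a\<bar> + 1 + 2 * \<bar>b\<bar>"
      using \<open>\<not> c \<ge> 0\<close> by (auto simp: t_def field_simps)
    have "t * (t * (-c)) \<ge> t * (\<bar>a\<bar> + 1 + 2 * \<bar>b\<bar>)" using t by (intro mult_left_mono) auto
    moreover have "t * (\<bar>a\<bar> + 1) \<ge> 1 * (\<bar>a\<bar> + 1)" using t by (intro mult_right_mono) auto
    moreover have "t * b \<le> t * \<bar>b\<bar>" using t by (intro mult_left_mono) auto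
    ultimately have "a + 2 * t * b + t\<^sup>2 * c < 0" by (simp add: power2_eq_square algebra_simps)
    then show False using assms[of t] by simp
  qed
  then have c: "c > 0" using False by simp
  \<comment> \<open>The point t = -b/c is the minimum of the parabola.\<close>
  have "a + 2 * (- b / c) * b + (- b / c)\<^sup>2 * c = a - b\<^sup>2 / c"
    using c by (simp add: power2_eq_square field_simps)
  then have "b\<^sup>2 / c \<le> a" using assms[of "- b / c"] by linarith
  then show ?thesis using c by (simp add: divide_le_eq)
qed

text \<open>The form is nonnegative along the line x + t y, which stays in V. Asking for
  semidefiniteness on V alone allows its use in the optimality argument of
  \<open>pencil_maximizer_on\<close>.\<close>

lemma psd_cauchy_schwarz_on:
  fixes J :: "real^'n^'n"
  assumes "transpose J = J" "subspace V" "\<And>v. v \<in> V \<Longrightarrow> (J *v v) \<bullet> v \<ge> 0" "x \<in> V" "y \<in> V"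
  shows "((J *v x) \<bullet> y)\<^sup>2 \<le> ((J *v x) \<bullet> x) * ((J *v y) \<bullet> y)"
proof (rule quadratic_nonneg_imp_discriminant)
  fix t :: real
  have "x + t *\<^sub>R y \<in> V" using assms by (simp add: subspace_add subspace_scale)
  then have "(J *v (x + t *\<^sub>R y)) \<bullet> (x + t *\<^sub>R y) \<ge> 0" using assms by blast
  then show "0 \<le> (J *v x) \<bullet> x + 2 * t * ((J *v x) \<bullet> y) + t\<^sup>2 * ((J *v y) \<bullet> y)"
    using symmetric_inner[OF assms(1), of y x]
    by (simp add: matrix_vector_right_distrib matrix_vector_mult_scaleR inner_simps power2_eq_square algebra_simps)
qed

lemma psd_cauchy_schwarz:
  fixes J :: "real^'n^'n"
  assumes "transpose J = J" "\<And>v. (J *v v) \<bullet> v \<ge> 0"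
  shows "((J *v x) \<bullet> y)\<^sup>2 \<le> ((J *v x) \<bullet> x) * ((J *v y) \<bullet> y)"
  using psd_cauchy_schwarz_on[OF assms(1) subspace_UNIV] assms(2) by blast

text \<open>Cauchy-Schwarz with y = J x bounds the fourth power of the norm of J x by zero.\<close>

lemma psd_kernel:
  fixes J :: "real^'n^'n"
  assumes "transpose J = J" "\<And>v. (J *v v) \<bullet> v \<ge> 0" "(J *v x) \<bullet> x = 0"
  shows "J *v x = 0"
  using psd_cauchy_schwarz[OF assms(1,2), of x "J *v x"] assms(3) by simp

section \<open>Basic facts on SPD matrices\<close>

lemma spd_invertible:
  assumes "spd X" shows "invertible X"
proof -
  have "\<forall>x. X *v x = 0 \<longrightarrow> x = 0" using assms unfolding spd_def by (metis inner_zero_left less_irrefl)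
  then show ?thesis using matrix_left_invertible_ker invertible_left_inverse by blast
qed

lemma spd_nonneg: "spd X \<Longrightarrow> (X *v v) \<bullet> v \<ge> 0"
  unfolding spd_def by (cases "v = 0") (auto intro: less_imp_le)

lemma spd_pos: "spd X \<Longrightarrow> v \<noteq> 0 \<Longrightarrow> (X *v v) \<bullet> v > 0"
  unfolding spd_def by auto

lemma spd_sym: "spd X \<Longrightarrow> transpose X = X"
  unfolding spd_def by auto

lemma spd_inverse_sym:
  assumes "spd X" shows "transpose (matrix_inv X) = matrix_inv X"
  by (rule symmetricI)
    (metis assms matrix_inv_cancel(1) spd_invertible spd_sym symmetric_inner inner_commute)

text \<open>Compactness of the unit sphere in V yields a maximizer u of the quotient of S by B.
  Stationarity at u is obtained without differentiation, from Cauchy-Schwarz for the form \<nu> B -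
  S.\<close>

lemma pencil_maximizer_on:
  fixes B S :: "real^'n^'n"
  assumes V: "subspace V" "\<exists>v\<in>V. v \<noteq> 0" and S: "transpose S = S" and B: "transpose B = B"
    and pos: "\<And>v. v \<in> V \<Longrightarrow> v \<noteq> 0 \<Longrightarrow> (B *v v) \<bullet> v > 0"
  obtains u \<nu> where "u \<in> V" "u \<noteq> 0"
    "\<And>x. x \<in> V \<Longrightarrow> (S *v x) \<bullet> x \<le> \<nu> * ((B *v x) \<bullet> x)"
    "\<And>h. h \<in> V \<Longrightarrow> (S *v u) \<bullet> h = \<nu> * ((B *v u) \<bullet> h)"
proof -
  define f where "f x = ((S *v x) \<bullet> x) / ((B *v x) \<bullet> x)" for x
  define K where "K = V \<inter> sphere 0 1"
  have normalized: "inverse (norm x) *\<^sub>R x \<in> K" if "x \<in> V" "x \<noteq> 0" for x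
    using that V by (auto simp: K_def subspace_scale)
  have "compact K" unfolding K_def
    using closed_subspace[OF V(1)] by (simp add: closed_Int_compact)
  moreover have "K \<noteq> {}" using normalized V(2) by blast
  moreover have "continuous_on K f" unfolding f_def
    using pos by (intro continuous_intros linear_continuous_on) (auto simp: K_def, fastforce)
  ultimately obtain u where u: "u \<in> K" "\<And>y. y \<in> K \<Longrightarrow> f y \<le> f u"
    using continuous_attains_sup by metis
  have uV: "u \<in> V" "u \<noteq> 0" using u by (auto simp: K_def)
  define \<nu> where "\<nu> = f u"
  have le: "(S *v x) \<bullet> x \<le> \<nu> * ((B *v x) \<bullet> x)" if "x \<in> V" for x
  proof (cases "x = 0")
    case False
    have "f (inverse (norm x) *\<^sub>R x) = f x"
      using False by (simp add: f_def matrix_vector_mult_scaleR)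
    then have "f x \<le> \<nu>" using u(2)[OF normalized[OF that False]] by (simp add: \<nu>_def)
    then show ?thesis using pos[OF that False] by (simp add: f_def field_simps)
  qed simp
  \<comment> \<open>D is semidefinite on V and its form vanishes at u, so u is D-orthogonal to all
    of V.\<close>
  define D where "D = \<nu> *\<^sub>R B - S"
  have Dv: "D *v x = \<nu> *\<^sub>R (B *v x) - S *v x" for x
    by (simp add: D_def matrix_vector_mult_diff_rdistrib scaleR_matrix_vector_assoc)
  have "transpose D = D" using S B by (simp add: D_def transpose_diff transpose_scalar)
  moreover have "(D *v v) \<bullet> v \<ge> 0" if "v \<in> V" for v
    using le[OF that] by (simp add: Dv inner_simps)
  moreover have "(D *v u) \<bullet> u = 0"
    using pos[OF uV] by (simp add: Dv inner_simps \<nu>_def f_def)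
  ultimately have "(D *v u) \<bullet> h = 0" if "h \<in> V" for h
    using psd_cauchy_schwarz_on[of D V u h] V uV that by simp
  then have "(S *v u) \<bullet> h = \<nu> * ((B *v u) \<bullet> h)" if "h \<in> V" for h
    using that by (fastforce simp: Dv inner_simps)
  then show ?thesis using that uV le by blast
qed

text \<open>For a singular J the problem is restricted to the range of J, where J is definite, and
  \<open>pencil_maximizer_on\<close> is applied to the pencil of J S J and J.\<close>

lemma psd_pencil_maximizer:
  fixes J S :: "real^'n^'n"
  assumes S: "transpose S = S" and J: "transpose J = J" "\<And>v. (J *v v) \<bullet> v \<ge> 0" and "J \<noteq> 0"
  obtains u \<nu> where "J *v u \<noteq> 0" "J *v (S *v (J *v u)) = \<nu> *\<^sub>R (J *v u)"
    "\<And>x. (S *v (J *v x)) \<bullet> (J *v x) \<le> \<nu> * ((J *v x) \<bullet> x)"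
proof -
  define V where "V = range ((*v) J)"
  have V: "subspace V" unfolding V_def
    by (intro linear_subspace_image matrix_vector_mul_linear subspace_UNIV)
  have "\<exists>v\<in>V. v \<noteq> 0" using \<open>J \<noteq> 0\<close> unfolding V_def
    by (metis matrix_eq matrix_vector_mult_0 rangeI)
  have proj: "v = 0" if "J *v v = 0" "v \<in> V" for v
  proof -
    obtain x where "v = J *v x" using \<open>v \<in> V\<close> by (auto simp: V_def)
    then have "v \<bullet> v = 0" using symmetric_inner[OF J(1), of x v] that by simp
    then show ?thesis by simp
  qed
  have pos: "(J *v v) \<bullet> v > 0" if "v \<in> V" "v \<noteq> 0" for v
    using J(2)[of v] psd_kernel[OF J, of v] proj that by fastforce
  define R where "R = J ** S ** J"
  have Rv: "R *v x = J *v (S *v (J *v x))" for x by (simp add: R_def matrix_vector_mul_assoc matrix_mul_assoc)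
  have Rsym: "transpose R = R" using J S by (simp add: R_def matrix_transpose_mul matrix_mul_assoc)
  obtain u \<nu> where u: "u \<in> V" "u \<noteq> 0"
    and le: "\<And>x. x \<in> V \<Longrightarrow> (R *v x) \<bullet> x \<le> \<nu> * ((J *v x) \<bullet> x)"
    and eq: "\<And>h. h \<in> V \<Longrightarrow> (R *v u) \<bullet> h = \<nu> * ((J *v u) \<bullet> h)"
    using pencil_maximizer_on[OF V \<open>\<exists>v\<in>V. v \<noteq> 0\<close> Rsym J(1) pos] by metis
  have "R *v u = \<nu> *\<^sub>R (J *v u)"
  proof -
    \<comment> \<open>The residual lies in V and is orthogonal to V.\<close>
    define d where "d = R *v u - \<nu> *\<^sub>R (J *v u)"
    have "d = J *v (S *v (J *v u) - \<nu> *\<^sub>R u)"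
      by (simp add: d_def Rv matrix_vector_mult_diff_distrib matrix_vector_mult_scaleR)
    then have "d \<in> V" by (simp add: V_def)
    then have "d \<bullet> d = 0" using eq[of d] by (simp add: d_def inner_diff_left)
    then show ?thesis by (simp add: d_def)
  qed
  moreover have "J *v u \<noteq> 0" using proj u by blast
  moreover have "(S *v (J *v x)) \<bullet> (J *v x) \<le> \<nu> * ((J *v x) \<bullet> x)" for x
  proof -
    \<comment> \<open>The part z orthogonal to the range of the symmetric J lies in its kernel, so
      the bound on V extends to every x.\<close>
    obtain y z where x: "x = y + z" "y \<in> V" "\<And>w. w \<in> V \<Longrightarrow> orthogonal z w"
      using orthogonal_subspace_decomp_exists[of V x] V span_eq_iff by metis
    have "(J *v z) \<bullet> w = 0" for w
      using x(3)[of "J *v w"] symmetric_inner[OF J(1), of z w]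
      by (simp add: V_def orthogonal_def inner_commute)
    then have "J *v z = 0" by (metis inner_eq_zero_iff)
    then have Jx: "J *v x = J *v y" by (simp add: x matrix_vector_right_distrib)
    have "(J *v x) \<bullet> x = (J *v y) \<bullet> y"
      using symmetric_inner[OF J(1), of y z] \<open>J *v z = 0\<close> by (simp add: Jx) (simp add: x inner_simps)
    moreover have "(R *v y) \<bullet> y = (S *v (J *v y)) \<bullet> (J *v y)"
      using symmetric_inner[OF J(1), of y "S *v (J *v y)"] by (simp add: Rv inner_commute)
    ultimately show ?thesis using le[OF x(2)] Jx by simp
  qed
  ultimately show ?thesis using that Rv by metis
qed

lemma spd_pencil_maximizer:
  fixes A S :: "real^'n^'n"
  assumes A: "spd A" and S: "transpose S = S"
  obtains u \<nu> where "u \<noteq> 0" "S *v u = \<nu> *\<^sub>R (A *v u)"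
    "\<And>x. (S *v x) \<bullet> x \<le> \<nu> * ((A *v x) \<bullet> x)"
proof -
  have "\<exists>v\<in>UNIV. v \<noteq> (0::real^'n)" by (metis UNIV_I axis_eq_0_iff zero_neq_one)
  then obtain u \<nu> where u: "u \<noteq> 0" "\<And>x. (S *v x) \<bullet> x \<le> \<nu> * ((A *v x) \<bullet> x)"
    "\<And>h. (S *v u) \<bullet> h = \<nu> * ((A *v u) \<bullet> h)"
    using pencil_maximizer_on[OF subspace_UNIV _ S spd_sym[OF A] spd_pos[OF A]] by (metis UNIV_I)
  have "S *v u = \<nu> *\<^sub>R (A *v u)"
    using u(3) by (intro vector_eq_rdot[THEN iffD1]) simp
  then show ?thesis using that u by blast
qed

section \<open>Extremal eigenvalues of SPD pencils\<close>

lemma eigenvalues_pencil: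
  fixes A S :: "real^'n^'n"
  assumes "spd A"
  shows "l \<in> eigenvalues (matrix_inv A ** S) \<longleftrightarrow> (\<exists>v. v \<noteq> 0 \<and> S *v v = l *\<^sub>R (A *v v))"
proof -
  have "matrix_inv A ** S *v v = l *\<^sub>R v \<longleftrightarrow> S *v v = l *\<^sub>R (A *v v)" for v
    using matrix_inv_cancel[OF spd_invertible[OF assms]]
    by (metis matrix_vector_mul_assoc matrix_vector_mult_scaleR)
  then show ?thesis by (simp add: eigenvalues_def)
qed

text \<open>Eigenvectors of different eigenvalues are A-orthogonal. One eigenvector per eigenvalue
  therefore gives an independent, hence finite, set. This makes the \<open>Min\<close> and
  \<open>Max\<close> in \<open>lambda_min\<close> and \<open>lambda_max\<close> meaningful.\<close>

lemma finite_eigenvalues_pencil: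
  fixes A S :: "real^'n^'n"
  assumes A: "spd A" and S: "transpose S = S"
  shows "finite (eigenvalues (matrix_inv A ** S))"
proof -
  let ?E = "eigenvalues (matrix_inv A ** S)"
  define w where "w l = (SOME v. v \<noteq> 0 \<and> S *v v = l *\<^sub>R (A *v v))" for l
  have w: "w l \<noteq> 0 \<and> S *v w l = l *\<^sub>R (A *v w l)" if "l \<in> ?E" for l
    unfolding w_def by (rule someI_ex) (use that eigenvalues_pencil[OF A] in blast)
  have orth: "(A *v w k) \<bullet> w l = 0" if "k \<in> ?E" "l \<in> ?E" "k \<noteq> l" for k l
  proof -
    have "k * ((A *v w k) \<bullet> w l) = (S *v w k) \<bullet> w l" using w[OF that(1)] by simp
    also have "\<dots> = (S *v w l) \<bullet> w k" by (rule symmetric_inner[OF S])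
    also have "\<dots> = l * ((A *v w k) \<bullet> w l)"
      using w[OF that(2)] symmetric_inner[OF spd_sym[OF A], of "w k"] by simp
    finally show ?thesis using that(3) by simp
  qed
  have inj: "inj_on w ?E"
  proof (rule inj_onI, rule ccontr)
    fix k l assume "k \<in> ?E" "l \<in> ?E" "w k = w l" "k \<noteq> l"
    then show False using orth[of k l] spd_pos[OF A, of "w l"] w[of l] by simp
  qed
  have "independent (w ` ?E)"
    unfolding independent_explicit_finite_subsets
  proof (intro allI impI ballI)
    fix T c v assume T: "T \<subseteq> w ` ?E" "finite T" "(\<Sum>x\<in>T. c x *\<^sub>R x) = 0" and v: "v \<in> T"
    \<comment> \<open>Pairing the vanishing combination with A v removes every term except that of
      v.\<close>
    have "0 = (A *v v) \<bullet> (\<Sum>x\<in>T. c x *\<^sub>R x)" using T by simp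
    also have "\<dots> = (\<Sum>x\<in>T. c x * ((A *v v) \<bullet> x))" by (simp add: inner_sum_right)
    also have "\<dots> = (\<Sum>x\<in>T. if x = v then c v * ((A *v v) \<bullet> v) else 0)"
    proof (rule sum.cong[OF refl])
      fix x assume "x \<in> T"
      then show "c x * ((A *v v) \<bullet> x) = (if x = v then c v * ((A *v v) \<bullet> v) else 0)"
        using T(1) v orth by (auto simp: subset_iff image_iff) metis
    qed
    also have "\<dots> = c v * ((A *v v) \<bullet> v)" using v T by simp
    finally show "c v = 0" using spd_pos[OF A, of v] w T(1) v by auto
  qed
  then have "finite (w ` ?E)" by (rule independent_imp_finite)
  then show ?thesis using inj finite_imageD by blast
qed

text \<open>The maximum of the Rayleigh quotient is an eigenvalue, and every eigenvalue is the
  quotient at its eigenvector, so the maximum is the largest eigenvalue.\<close>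

lemma lambda_max_pencil:
  fixes A S :: "real^'n^'n"
  assumes A: "spd A" and S: "transpose S = S"
  obtains u where "u \<noteq> 0" "S *v u = lambda_max (matrix_inv A ** S) *\<^sub>R (A *v u)"
    "\<And>x. (S *v x) \<bullet> x \<le> lambda_max (matrix_inv A ** S) * ((A *v x) \<bullet> x)"
proof -
  obtain u \<nu> where u: "u \<noteq> 0" "S *v u = \<nu> *\<^sub>R (A *v u)"
    "\<And>x. (S *v x) \<bullet> x \<le> \<nu> * ((A *v x) \<bullet> x)"
    using spd_pencil_maximizer[OF A S] by metis
  have "lambda_max (matrix_inv A ** S) = \<nu>" unfolding lambda_max_def
  proof (rule Max_eqI[OF finite_eigenvalues_pencil[OF A S]])
    show "\<nu> \<in> eigenvalues (matrix_inv A ** S)" using u eigenvalues_pencil[OF A] by blast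
    fix l assume "l \<in> eigenvalues (matrix_inv A ** S)"
    then obtain v where v: "v \<noteq> 0" "S *v v = l *\<^sub>R (A *v v)" using eigenvalues_pencil[OF A] by blast
    show "l \<le> \<nu>" using u(3)[of v] v spd_pos[OF A, of v] by simp
  qed
  then show ?thesis using that u by blast
qed

text \<open>The maximizer for - S is a minimizer for S.\<close>

lemma lambda_min_pencil:
  fixes A S :: "real^'n^'n"
  assumes A: "spd A" and S: "transpose S = S"
  obtains u where "u \<noteq> 0" "S *v u = lambda_min (matrix_inv A ** S) *\<^sub>R (A *v u)"
    "\<And>x. lambda_min (matrix_inv A ** S) * ((A *v x) \<bullet> x) \<le> (S *v x) \<bullet> x"
proof -
  have "transpose (- S) = - S" using S by (simp add: transpose_uminus)
  from spd_pencil_maximizer[OF A this]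
  obtain u \<nu> where "u \<noteq> 0" "- S *v u = \<nu> *\<^sub>R (A *v u)"
    "\<And>x. (- S *v x) \<bullet> x \<le> \<nu> * ((A *v x) \<bullet> x)" by metis
  then have u: "u \<noteq> 0" "S *v u = (- \<nu>) *\<^sub>R (A *v u)"
    "\<And>x. (- \<nu>) * ((A *v x) \<bullet> x) \<le> (S *v x) \<bullet> x"
    by (simp_all add: matrix_vector_mult_minus) (metis minus_equation_iff, smt (verit))
  have "lambda_min (matrix_inv A ** S) = - \<nu>" unfolding lambda_min_def
  proof (rule Min_eqI[OF finite_eigenvalues_pencil[OF A S]])
    show "- \<nu> \<in> eigenvalues (matrix_inv A ** S)" using u eigenvalues_pencil[OF A] by blast
    fix l assume "l \<in> eigenvalues (matrix_inv A ** S)"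
    then obtain v where v: "v \<noteq> 0" "S *v v = l *\<^sub>R (A *v v)" using eigenvalues_pencil[OF A] by blast
    have "(- \<nu>) * ((A *v v) \<bullet> v) \<le> l * ((A *v v) \<bullet> v)" using u(3)[of v] v by simp
    then show "- \<nu> \<le> l" using spd_pos[OF A v(1)] mult_le_cancel_right_pos by blast
  qed
  then show ?thesis using that u by metis
qed

section \<open>The energy norm and dominated pencils\<close>

text \<open>The squared norm is the largest eigenvalue of the pencil of E^T A E and A. The
  eigenvector equation is kept because it is what \<open>mnorm_le_if_eigenvalues_le\<close>
  exploits.\<close>

lemma mnorm_attained:
  fixes A E :: "real^'n^'n"
  assumes A: "spd A"
  obtains u s where "u \<noteq> 0" "s \<ge> 0" "transpose E *v (A *v (E *v u)) = s\<^sup>2 *\<^sub>R (A *v u)"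
    "mnorm A E = s" "\<And>v. vnorm A (E *v v) \<le> s * vnorm A v"
proof -
  define S where "S = transpose E ** A ** E"
  have Sv: "S *v x = transpose E *v (A *v (E *v x))" for x
    by (simp add: S_def matrix_vector_mul_assoc matrix_mul_assoc)
  have quad: "(S *v x) \<bullet> x = (A *v (E *v x)) \<bullet> (E *v x)" for x
    by (simp add: Sv inner_matrix_transpose[of "transpose E"])
  have "transpose S = S" using spd_sym[OF A] by (simp add: S_def matrix_transpose_mul matrix_mul_assoc)
  from spd_pencil_maximizer[OF A this] obtain u \<sigma> where u: "u \<noteq> 0" "S *v u = \<sigma> *\<^sub>R (A *v u)"
    "\<And>x. (S *v x) \<bullet> x \<le> \<sigma> * ((A *v x) \<bullet> x)" by metis
  have "\<sigma> * ((A *v u) \<bullet> u) \<ge> 0" using quad[of u] u spd_nonneg[OF A, of "E *v u"] by simp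
  then have \<sigma>: "\<sigma> \<ge> 0" using spd_pos[OF A u(1)] by (simp add: zero_le_mult_iff)
  define s where "s = sqrt \<sigma>"
  have le: "vnorm A (E *v v) \<le> s * vnorm A v" for v
    using u(3)[of v] by (simp add: vnorm_def s_def quad flip: real_sqrt_mult)
  have vpos: "vnorm A v > 0" if "v \<noteq> 0" for v using spd_pos[OF A that] by (simp add: vnorm_def)
  have "(A *v (E *v u)) \<bullet> (E *v u) = \<sigma> * ((A *v u) \<bullet> u)" using quad[of u] u by simp
  then have att: "vnorm A (E *v u) / vnorm A u = s"
    using vpos[OF u(1)] by (simp add: vnorm_def s_def real_sqrt_mult)
  have "mnorm A E = s" unfolding mnorm_def
  proof (rule cSup_eq_maximum)
    show "s \<in> (\<lambda>v. vnorm A (E *v v) / vnorm A v) ` (UNIV - {0})" using att u(1) by blast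
    fix t assume "t \<in> (\<lambda>v. vnorm A (E *v v) / vnorm A v) ` (UNIV - {0})"
    then obtain v where "v \<noteq> 0" "t = vnorm A (E *v v) / vnorm A v" by blast
    then show "t \<le> s" using le vpos by (simp add: pos_divide_le_eq)
  qed
  moreover have "s\<^sup>2 = \<sigma>" "s \<ge> 0" using \<sigma> by (simp_all add: s_def)
  ultimately show ?thesis using that u Sv le by metis
qed

lemma mnorm_nonneg: "spd A \<Longrightarrow> mnorm A E \<ge> 0"
  using mnorm_attained by metis

lemma abs_eigenvalue_le_mnorm:
  assumes A: "spd A" and v: "v \<noteq> 0" "E *v v = \<epsilon> *\<^sub>R v"
  shows "\<bar>\<epsilon>\<bar> \<le> mnorm A E"
proof -
  have pos: "vnorm A v > 0" using spd_pos[OF A v(1)] by (simp add: vnorm_def)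
  have "vnorm A (E *v v) = \<bar>\<epsilon>\<bar> * vnorm A v"
    by (simp add: v(2) vnorm_def matrix_vector_mult_scaleR real_sqrt_mult flip: mult.assoc power2_eq_square)
  then show ?thesis using mnorm_attained[OF A, of E] pos by (metis mult_le_cancel_right_pos)
qed

text \<open>Symmetry of A E means that E is selfadjoint in the A-inner product. The equation for the
  norm s then becomes E E u = s^2 u, which forces s or -s to be an eigenvalue of E.\<close>

lemma mnorm_le_if_eigenvalues_le:
  fixes A E :: "real^'n^'n"
  assumes A: "spd A" and sym: "transpose (A ** E) = A ** E"
    and le: "\<And>\<epsilon> v. v \<noteq> 0 \<Longrightarrow> E *v v = \<epsilon> *\<^sub>R v \<Longrightarrow> \<bar>\<epsilon>\<bar> \<le> b"
  shows "mnorm A E \<le> b"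
proof -
  obtain u s where u: "u \<noteq> 0" "s \<ge> 0" "transpose E *v (A *v (E *v u)) = s\<^sup>2 *\<^sub>R (A *v u)"
    "mnorm A E = s" using mnorm_attained[OF A] by metis
  have "transpose E ** A = A ** E" using sym spd_sym[OF A] by (simp add: matrix_transpose_mul)
  then have "A *v (E *v (E *v u)) = A *v (s\<^sup>2 *\<^sub>R u)"
    using u(3) by (metis matrix_vector_mul_assoc matrix_vector_mult_scaleR)
  then have EE: "E *v (E *v u) = s\<^sup>2 *\<^sub>R u" by (metis matrix_inv_cancel(2)[OF spd_invertible[OF A]])
  \<comment> \<open>From (E - s)(E + s) u = 0: either w vanishes and u belongs to -s, or w belongs
    to s.\<close>
  define w where "w = E *v u + s *\<^sub>R u"
  have "s \<le> b"
  proof (cases "w = 0")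
    case True
    then have "E *v u = (- s) *\<^sub>R u" by (simp add: w_def add_eq_0_iff)
    then show ?thesis using le[OF u(1)] u(2) by fastforce
  next
    case False
    have "E *v w = s *\<^sub>R w"
      by (simp add: w_def matrix_vector_right_distrib EE matrix_vector_mult_scaleR scaleR_add_right power2_eq_square)
    then show ?thesis using le[OF False] u(2) by fastforce
  qed
  then show ?thesis using u(4) by simp
qed

section \<open>Inverses, congruences and the Loewner order\<close>

lemma spd_inverse:
  assumes "spd X" shows "spd (matrix_inv X)"
proof -
  note inv = matrix_inv_cancel[OF spd_invertible[OF assms]]
  have "(matrix_inv X *v v) \<bullet> v > 0" if "v \<noteq> 0" for v
  proof -
    have "matrix_inv X *v v \<noteq> 0" using inv(1)[of v] that by auto
    from spd_pos[OF assms this] show ?thesis by (simp add: inv inner_commute)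
  qed
  then show ?thesis using spd_inverse_sym[OF assms] by (simp add: spd_def)
qed

lemma spd_congruence:
  fixes X :: "real^'n^'n" and P :: "real^'c^'n"
  assumes "spd X" "inj ((*v) P)" shows "spd (transpose P ** X ** P)"
proof -
  have "(transpose P ** X ** P *v v) \<bullet> v > 0" if "v \<noteq> 0" for v
  proof -
    have "P *v v \<noteq> 0" using assms(2) that by (metis injD matrix_vector_mult_0_right)
    from spd_pos[OF assms(1) this] show ?thesis
      by (simp add: inner_matrix_transpose[of "transpose P"] flip: matrix_vector_mul_assoc)
  qed
  then show ?thesis using spd_sym[OF assms(1)] by (simp add: spd_def matrix_transpose_mul matrix_mul_assoc)
qed

text \<open>Cauchy-Schwarz in the X-inner product between X^-1 g and Y^-1 g, followed by the
  hypothesis at Y^-1 g; one positive factor cancels.\<close>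

lemma spd_inverse_antimono:
  assumes X: "spd X" and Y: "spd Y" and "c \<ge> 0" and le: "\<And>v. (X *v v) \<bullet> v \<le> c * ((Y *v v) \<bullet> v)"
  shows "(matrix_inv Y *v g) \<bullet> g \<le> c * ((matrix_inv X *v g) \<bullet> g)"
proof (cases "g = 0")
  case False
  define a where "a = matrix_inv Y *v g"
  define b where "b = matrix_inv X *v g"
  have Ya: "Y *v a = g" and Xb: "X *v b = g"
    using X Y by (simp_all add: a_def b_def matrix_inv_cancel spd_invertible)
  have pos: "a \<bullet> g > 0" using spd_pos[OF spd_inverse[OF Y] False] by (simp add: a_def)
  have bpos: "b \<bullet> g \<ge> 0" using spd_nonneg[OF spd_inverse[OF X]] by (simp add: b_def)
  have "((X *v b) \<bullet> a)\<^sup>2 \<le> ((X *v b) \<bullet> b) * ((X *v a) \<bullet> a)"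
    by (rule psd_cauchy_schwarz[OF spd_sym[OF X] spd_nonneg[OF X]])
  also have "\<dots> \<le> (b \<bullet> g) * (c * (a \<bullet> g))"
    using le[of a] bpos by (simp add: Xb Ya inner_commute mult_left_mono)
  finally have "(a \<bullet> g) * (a \<bullet> g) \<le> (c * (b \<bullet> g)) * (a \<bullet> g)"
    by (simp add: Xb inner_commute power2_eq_square mult_ac)
  then show ?thesis using pos by (simp add: a_def b_def)
qed simp

text \<open>The order A \<le> N makes every eigenvalue of A^-1 N at least 1, so that
  \<open>C\<close> is positive semidefinite in the N-inner product. The role of \<open>N\<close>
  will be taken by \<open>Mtilde A M\<close>.\<close>

locale spd_dominated =
  fixes A N :: "real^'n^'n"
  assumes spd_A: "spd A" and spd_N: "spd N"
    and A_le_N: "\<And>v. (A *v v) \<bullet> v \<le> (N *v v) \<bullet> v"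
begin

definition C :: "real^'n^'n" where "C = matrix_inv A ** N - mat 1"

lemma C_vec: "C *v x = matrix_inv A *v (N *v x) - x"
  by (simp add: C_def matrix_vector_mult_diff_rdistrib matrix_vector_mul_assoc)

section \<open>The operator \<open>C\<close> in the N-inner product\<close>

lemma A_C: "A *v (C *v x) = N *v x - A *v x"
  by (simp add: C_vec matrix_vector_mult_diff_distrib matrix_inv_cancel spd_invertible[OF spd_A])

lemma N_inner: "(N *v x) \<bullet> y = (N *v y) \<bullet> x"
  by (rule symmetric_inner[OF spd_sym[OF spd_N]])

lemma NC_inner: "(N *v (C *v x)) \<bullet> y = (N *v (C *v y)) \<bullet> x"
proof -
  have "(N *v (matrix_inv A *v (N *v x))) \<bullet> y = (N *v (matrix_inv A *v (N *v y))) \<bullet> x"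
    using symmetric_inner[OF spd_inverse_sym[OF spd_A], of "N *v x" "N *v y"]
      N_inner[of "matrix_inv A *v (N *v x)" y] N_inner[of "matrix_inv A *v (N *v y)" x]
    by (simp add: inner_commute)
  then show ?thesis
    using N_inner[of x y] by (simp add: C_vec matrix_vector_mult_diff_distrib inner_diff_left)
qed

text \<open>Inverting m A \<le> N gives m N \<le> N A^-1 N, and N C = N A^-1 N - N. The inversion is
  Cauchy-Schwarz in the A-inner product between A^-1 N x and x.\<close>

lemma NC_lower:
  assumes "m > 0" "\<And>v. m * ((A *v v) \<bullet> v) \<le> (N *v v) \<bullet> v"
  shows "(m - 1) * ((N *v x) \<bullet> x) \<le> (N *v (C *v x)) \<bullet> x"
proof (cases "x = 0")
  case False
  define y where "y = matrix_inv A *v (N *v x)"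
  have Ay: "A *v y = N *v x" by (simp add: y_def matrix_inv_cancel spd_invertible[OF spd_A])
  have pos: "(N *v x) \<bullet> x > 0" using spd_pos[OF spd_N False] .
  have yx: "(N *v y) \<bullet> x = (A *v y) \<bullet> y" by (simp add: Ay N_inner[of y x])
  have "((A *v y) \<bullet> x)\<^sup>2 \<le> ((A *v y) \<bullet> y) * ((A *v x) \<bullet> x)"
    by (rule psd_cauchy_schwarz[OF spd_sym[OF spd_A] spd_nonneg[OF spd_A]])
  then have "m * ((N *v x) \<bullet> x)\<^sup>2 \<le> ((A *v y) \<bullet> y) * (m * ((A *v x) \<bullet> x))"
    using assms(1) by (simp add: Ay mult.left_commute)
  also have "\<dots> \<le> ((A *v y) \<bullet> y) * ((N *v x) \<bullet> x)"
    using assms(2) spd_nonneg[OF spd_A] by (intro mult_left_mono) auto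
  finally have "(m * ((N *v x) \<bullet> x)) * ((N *v x) \<bullet> x) \<le> ((N *v y) \<bullet> x) * ((N *v x) \<bullet> x)"
    by (simp add: yx power2_eq_square mult.assoc)
  then have "m * ((N *v x) \<bullet> x) \<le> (N *v y) \<bullet> x" using pos by simp
  then show ?thesis
    by (simp add: C_vec matrix_vector_mult_diff_distrib inner_diff_left algebra_simps flip: y_def)
qed simp

lemma NC_nonneg: "(N *v (C *v x)) \<bullet> x \<ge> 0"
  using NC_lower[of 1 x] A_le_N by simp

lemma NC_vec: "(N ** C) *v x = N *v (C *v x)"
  by (simp add: matrix_vector_mul_assoc)

lemma transpose_NC: "transpose (N ** C) = N ** C"
  by (rule symmetricI) (simp only: NC_vec NC_inner)

lemma NC_cauchy_schwarz:
  "((N *v (C *v x)) \<bullet> y)\<^sup>2 \<le> ((N *v (C *v x)) \<bullet> x) * ((N *v (C *v y)) \<bullet> y)"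
  using psd_cauchy_schwarz[OF transpose_NC] NC_nonneg by (simp add: NC_vec)

lemma NC_pos:
  assumes "C *v x \<noteq> 0" shows "(N *v (C *v x)) \<bullet> x > 0"
proof -
  have "N *v (C *v x) \<noteq> 0" using assms by (metis matrix_inv_cancel(2) matrix_vector_mult_0_right spd_N spd_invertible)
  then have "(N *v (C *v x)) \<bullet> x \<noteq> 0"
    using psd_kernel[OF transpose_NC] NC_nonneg by (auto simp: NC_vec)
  then show ?thesis using NC_nonneg[of x] by simp
qed

text \<open>In the N-inner product \<open>NC_lower\<close> says C \<ge> m - 1; this is the
  consequence C^2 \<ge> (m - 1) C, by Cauchy-Schwarz between C x and x.\<close>

lemma NCC_lower:
  assumes "m \<ge> 1" "\<And>v. m * ((A *v v) \<bullet> v) \<le> (N *v v) \<bullet> v"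
  shows "(m - 1) * ((N *v (C *v x)) \<bullet> x) \<le> (N *v (C *v x)) \<bullet> (C *v x)"
proof (cases "C *v x = 0")
  case False
  define c where "c = (N *v (C *v x)) \<bullet> x"
  have c: "c > 0" using NC_pos[OF False] by (simp add: c_def)
  have "((N *v (C *v x)) \<bullet> x)\<^sup>2 \<le> ((N *v (C *v x)) \<bullet> (C *v x)) * ((N *v x) \<bullet> x)"
    by (rule psd_cauchy_schwarz[OF spd_sym[OF spd_N] spd_nonneg[OF spd_N]])
  then have "(m - 1) * c\<^sup>2 \<le> (m - 1) * (((N *v (C *v x)) \<bullet> (C *v x)) * ((N *v x) \<bullet> x))"
    using assms(1) by (simp add: c_def mult_left_mono)
  also have "\<dots> = ((N *v (C *v x)) \<bullet> (C *v x)) * ((m - 1) * ((N *v x) \<bullet> x))" by simp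
  also have "\<dots> \<le> ((N *v (C *v x)) \<bullet> (C *v x)) * c"
    unfolding c_def using NC_lower assms spd_nonneg[OF spd_N] by (intro mult_left_mono) auto
  finally have "((m - 1) * c) * c \<le> ((N *v (C *v x)) \<bullet> (C *v x)) * c"
    by (simp add: power2_eq_square mult.assoc)
  then show ?thesis using c by (simp add: c_def)
qed simp

text \<open>For m > 1 the bound of \<open>NC_lower\<close> makes C injective. Trial vectors can then
  be found whose image under C is prescribed.\<close>

lemma C_surjective:
  assumes "m > 1" "\<And>v. m * ((A *v v) \<bullet> v) \<le> (N *v v) \<bullet> v"
  obtains x where "C *v x = z"
proof -
  have "x = 0" if "C *v x = 0" for x
  proof (rule ccontr)
    assume "x \<noteq> 0"
    then have "(m - 1) * ((N *v x) \<bullet> x) > 0" using spd_pos[OF spd_N] assms(1) by simp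
    then show False using NC_lower[of m x] assms that by simp
  qed
  then have "inj ((*v) C)" using matrix_left_invertible_ker matrix_left_invertible_injective by blast
  then have "surj ((*v) C)" using linear_injective_imp_surjective[OF matrix_vector_mul_linear] by blast
  then show ?thesis using that by (metis surjD)
qed

text \<open>R is an N-orthogonal projection with nonzero range, and \<kappa> bounds the Rayleigh
  quotient of N R against A. The results are applied to the identity, to the coarse projection and
  to its complement.\<close>

context
  fixes R :: "real^'n^'n" and \<kappa> :: real
  assumes nontrivial: "\<exists>z. z \<noteq> 0 \<and> R *v z = z"
    and idem: "\<And>v. R *v (R *v v) = R *v v"
    and NR_inner: "\<And>x y. (N *v (R *v x)) \<bullet> y = (N *v (R *v y)) \<bullet> x"
    and kappa_max: "\<And>x. (N *v (R *v x)) \<bullet> x \<le> \<kappa> * ((A *v x) \<bullet> x)"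
begin

lemma projection_quadratic: "(N *v (R *v x)) \<bullet> y = (N *v (R *v x)) \<bullet> (R *v y)"
  by (metis idem NR_inner)

lemma projection_kappa_ge_1: "\<kappa> \<ge> 1"
proof -
  obtain z where z: "z \<noteq> 0" "R *v z = z" using nontrivial by blast
  have "(A *v z) \<bullet> z \<le> \<kappa> * ((A *v z) \<bullet> z)" using kappa_max[of z] A_le_N[of z] z by simp
  then show ?thesis using spd_pos[OF spd_A z(1)] by simp
qed

text \<open>Two applications of Cauchy-Schwarz: one in the N-inner product bounds the form of N C on
  the range of R by \<kappa> - 1 times that of N, the other in the form of N C carries this bound
  over from z = R C x to x.\<close>

lemma projection_upper:
  "(N *v (R *v (C *v x))) \<bullet> (C *v x) \<le> (\<kappa> - 1) * ((N *v (C *v x)) \<bullet> x)"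
proof -
  define z where "z = R *v (C *v x)"
  have Rz: "R *v z = z" by (simp add: z_def idem)
  define y where "y = matrix_inv A *v (N *v z)"
  have Ay: "A *v y = N *v z" by (simp add: y_def matrix_inv_cancel spd_invertible[OF spd_A])
  have lhs: "(N *v (R *v (C *v x))) \<bullet> (C *v x) = (N *v z) \<bullet> z"
    using projection_quadratic by (simp add: z_def)
  show ?thesis
  proof (cases "z = 0")
    case True
    then show ?thesis using NC_nonneg[of x] lhs projection_kappa_ge_1 by simp
  next
    case False
    have nz: "(N *v z) \<bullet> z > 0" using spd_pos[OF spd_N False] .
    have zy: "(N *v z) \<bullet> y = (N *v z) \<bullet> (R *v y)" using projection_quadratic[of z y] Rz by simp
    have yy: "(N *v (R *v y)) \<bullet> (R *v y) = (N *v (R *v y)) \<bullet> y" using projection_quadratic[of y y] by simp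
    have zy_nonneg: "(N *v z) \<bullet> y \<ge> 0" using spd_nonneg[OF spd_A, of y] Ay by simp
    \<comment> \<open>Compares z with R y, where A y = N z; \<open>kappa_max\<close> at y then
      returns the same quantity, and one factor cancels.\<close>
    have "((N *v z) \<bullet> (R *v y))\<^sup>2 \<le> ((N *v z) \<bullet> z) * ((N *v (R *v y)) \<bullet> (R *v y))"
      by (rule psd_cauchy_schwarz[OF spd_sym[OF spd_N] spd_nonneg[OF spd_N]])
    also have "\<dots> \<le> ((N *v z) \<bullet> z) * (\<kappa> * ((N *v z) \<bullet> y))"
      using kappa_max[of y] nz by (simp add: yy Ay)
    finally have "((N *v z) \<bullet> y) * ((N *v z) \<bullet> y) \<le> (\<kappa> * ((N *v z) \<bullet> z)) * ((N *v z) \<bullet> y)"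
      by (simp add: zy[symmetric] power2_eq_square mult_ac)
    then have "(N *v z) \<bullet> y \<le> \<kappa> * ((N *v z) \<bullet> z)"
      using zy_nonneg nz projection_kappa_ge_1 by (cases "(N *v z) \<bullet> y = 0") auto
    moreover have "(N *v (C *v z)) \<bullet> z = (N *v z) \<bullet> y - (N *v z) \<bullet> z"
      using N_inner[of y z] by (simp add: C_vec matrix_vector_mult_diff_distrib inner_diff_left flip: y_def)
    ultimately have cz: "(N *v (C *v z)) \<bullet> z \<le> (\<kappa> - 1) * ((N *v z) \<bullet> z)" by (simp add: algebra_simps)
    \<comment> \<open>Since z is the projection of C x, the squared N-norm of z is the N C pairing
      of x with z.\<close>
    have "(N *v z) \<bullet> z = (N *v (C *v x)) \<bullet> z"
      using NR_inner[of z "C *v x"] Rz lhs projection_quadratic[of "C *v x" "C *v x"]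
      by (metis N_inner z_def)
    then have "((N *v z) \<bullet> z)\<^sup>2 \<le> ((N *v (C *v x)) \<bullet> x) * ((N *v (C *v z)) \<bullet> z)"
      using NC_cauchy_schwarz[of x z] by simp
    also have "\<dots> \<le> ((N *v (C *v x)) \<bullet> x) * ((\<kappa> - 1) * ((N *v z) \<bullet> z))"
      by (rule mult_left_mono[OF cz NC_nonneg])
    finally have "((N *v z) \<bullet> z) * ((N *v z) \<bullet> z) \<le> ((\<kappa> - 1) * ((N *v (C *v x)) \<bullet> x)) * ((N *v z) \<bullet> z)"
      by (simp add: power2_eq_square mult_ac)
    then show ?thesis using nz lhs by simp
  qed
qed

text \<open>The witness is R u for an eigenvector u of the pencil: A^-1 N R u = \<kappa> u gives R C
  z = (\<kappa> - 1) z for z = R u.\<close>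

lemma projection_upper_attained:
  assumes "\<kappa> > 1" "u \<noteq> 0" "N *v (R *v u) = \<kappa> *\<^sub>R (A *v u)"
  obtains z where "(N *v (C *v z)) \<bullet> z > 0"
    "(N *v (R *v (C *v z))) \<bullet> (C *v z) = (\<kappa> - 1) * ((N *v (C *v z)) \<bullet> z)"
proof -
  define z where "z = R *v u"
  have Rz: "R *v z = z" by (simp add: z_def idem)
  have "A *v u \<noteq> 0" using spd_pos[OF spd_A assms(2)] by auto
  then have "N *v z \<noteq> 0" using assms by (simp add: z_def)
  then have z0: "z \<noteq> 0" by auto
  have "matrix_inv A *v (N *v z) = \<kappa> *\<^sub>R u"
    by (simp add: z_def assms(3) matrix_vector_mult_scaleR matrix_inv_cancel spd_invertible[OF spd_A])
  then have RCz: "R *v (C *v z) = (\<kappa> - 1) *\<^sub>R z"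
    by (simp add: C_vec matrix_vector_mult_diff_distrib matrix_vector_mult_scaleR Rz scaleR_diff_left)
      (simp add: z_def)
  have "(N *v (C *v z)) \<bullet> z = (N *v (R *v (C *v z))) \<bullet> z"
    by (metis NR_inner N_inner Rz)
  then have c: "(N *v (C *v z)) \<bullet> z = (\<kappa> - 1) * ((N *v z) \<bullet> z)"
    by (simp add: RCz matrix_vector_mult_scaleR)
  have "(N *v (R *v (C *v z))) \<bullet> (C *v z) = (\<kappa> - 1) * ((N *v (C *v z)) \<bullet> z)"
    by (metis RCz matrix_vector_mult_scaleR inner_scaleR_left N_inner)
  moreover have "(N *v (C *v z)) \<bullet> z > 0" using c assms(1) spd_pos[OF spd_N z0] by simp
  ultimately show ?thesis using that by blast
qed

end

end

section \<open>The inexact two-grid error operator\<close>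

text \<open>X and Y stand for I - M^-T A and I - M^-1 A, and \<Theta> for the inexact coarse
  correction P Bc^-1 P^T A. \<open>smoother\<close> says Y X = I - N^-1 A. \<open>Q_coarse\<close>
  is the form in which the Woodbury formula enters.\<close>

locale inexact_two_grid = spd_dominated A N for A N :: "real^'n^'n" +
  fixes X Y \<Theta> Q :: "real^'n^'n"
  assumes smoother: "\<And>v. N *v (Y *v (X *v v)) = N *v v - A *v v"
    and smoother_adjoint: "\<And>x y. (A *v (X *v x)) \<bullet> y = (A *v x) \<bullet> (Y *v y)"
    and A\<Theta>_inner: "\<And>x y. (A *v (\<Theta> *v x)) \<bullet> y = (A *v (\<Theta> *v y)) \<bullet> x"
    and NQ_inner: "\<And>x y. (N *v (Q *v x)) \<bullet> y = (N *v (Q *v y)) \<bullet> x"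
    and Q_coarse: "\<And>w z. N *v z = A *v (w - \<Theta> *v w) \<Longrightarrow> Q *v (\<Theta> *v w + z) = \<Theta> *v w"
begin

section \<open>The error operator and its cyclic permutation\<close>

definition E :: "real^'n^'n" where "E = X ** (mat 1 - \<Theta>) ** Y"

definition F :: "real^'n^'n" where "F = Y ** X ** (mat 1 - \<Theta>)"

lemma E_vec: "E *v v = X *v (Y *v v - \<Theta> *v (Y *v v))"
  by (simp add: E_def matrix_vector_mult_diff_rdistrib flip: matrix_vector_mul_assoc)

lemma F_vec: "F *v v = Y *v (X *v (v - \<Theta> *v v))"
  by (simp add: F_def matrix_vector_mult_diff_rdistrib flip: matrix_vector_mul_assoc)

lemma transpose_AE: "transpose (A ** E) = A ** E"
proof (rule symmetricI)
  fix x y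
  have "(A *v (E *v x)) \<bullet> y = (A *v (Y *v x - \<Theta> *v (Y *v x))) \<bullet> (Y *v y)" for x y
    by (simp add: E_vec smoother_adjoint)
  then have "(A *v (E *v x)) \<bullet> y = (A *v (E *v y)) \<bullet> x"
    using A\<Theta>_inner[of "Y *v x" "Y *v y"] symmetric_inner[OF spd_sym[OF spd_A], of "Y *v x" "Y *v y"]
    by (simp add: matrix_vector_mult_diff_distrib inner_diff_left)
  then show "(A ** E *v x) \<bullet> y = (A ** E *v y) \<bullet> x" by (simp flip: matrix_vector_mul_assoc)
qed

lemma A_cancel: "A *v x = A *v y \<Longrightarrow> x = y"
  by (metis matrix_inv_cancel(2) spd_A spd_invertible)

lemma N_cancel: "N *v x = N *v y \<Longrightarrow> x = y"
  by (metis matrix_inv_cancel(2) spd_N spd_invertible)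

(* C (I - Q) = F (I - F)^{-1}, so the two matrices have the same eigenvectors. *)
lemma C_Q_F: "C *v ((w - F *v w) - Q *v (w - F *v w)) = F *v w"
proof -
  define y where "y = w - \<Theta> *v w"
  \<comment> \<open>By \<open>smoother\<close>, z = N^-1 A (I - \<Theta>) w, as
    \<open>Q_coarse\<close> requires.\<close>
  define z where "z = y - F *v w"
  have Nz: "N *v z = A *v y"
    using smoother[of y] by (simp add: z_def F_vec matrix_vector_mult_diff_distrib flip: y_def)
  have g: "w - F *v w = \<Theta> *v w + z" by (simp add: z_def y_def)
  have "Q *v (w - F *v w) = \<Theta> *v w" unfolding g by (rule Q_coarse) (simp add: Nz y_def)
  then have "(w - F *v w) - Q *v (w - F *v w) = z" by (simp add: g)
  moreover have "C *v z = F *v w"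
    by (rule A_cancel, simp only: A_C Nz) (simp add: z_def matrix_vector_mult_diff_distrib)
  ultimately show ?thesis by simp
qed

text \<open>Cyclic permutation: w = Y v is an eigenvector of F for the same nonzero eigenvalue. Then
  \<open>C_Q_F\<close> gives \<nu> = \<epsilon> / (1 - \<epsilon>); the value \<epsilon> = 1 is
  excluded because it would force w = 0.\<close>

lemma eigenpair_from_E:
  assumes v: "v \<noteq> 0" "E *v v = \<epsilon> *\<^sub>R v" and "\<epsilon> \<noteq> 0"
  obtains w \<nu> where "w \<noteq> 0" "\<nu> \<noteq> 0" "C *v (w - Q *v w) = \<nu> *\<^sub>R w" "1 + \<nu> \<noteq> 0" "\<epsilon> = \<nu> / (1 + \<nu>)"
proof -
  define w where "w = Y *v v"
  have Fw: "F *v w = \<epsilon> *\<^sub>R w"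
    using arg_cong[OF v(2), of "(*v) Y"] by (simp add: E_vec F_vec w_def matrix_vector_mult_scaleR)
  have "E *v v \<noteq> 0" using v \<open>\<epsilon> \<noteq> 0\<close> by simp
  then have w0: "w \<noteq> 0" by (auto simp: E_vec w_def)
  have "w - F *v w = (1 - \<epsilon>) *\<^sub>R w" by (simp add: Fw scaleR_diff_left)
  then have eq: "(1 - \<epsilon>) *\<^sub>R (C *v (w - Q *v w)) = \<epsilon> *\<^sub>R w"
    using C_Q_F[of w] by (simp add: Fw matrix_vector_mult_scaleR flip: scaleR_diff_right)
  have e1: "1 - \<epsilon> \<noteq> 0" using eq w0 \<open>\<epsilon> \<noteq> 0\<close> by auto
  have "C *v (w - Q *v w) = inverse (1 - \<epsilon>) *\<^sub>R ((1 - \<epsilon>) *\<^sub>R (C *v (w - Q *v w)))" using e1 by simp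
  also have "\<dots> = (\<epsilon> / (1 - \<epsilon>)) *\<^sub>R w" by (simp only: eq) (simp add: divide_inverse mult.commute)
  finally have "C *v (w - Q *v w) = (\<epsilon> / (1 - \<epsilon>)) *\<^sub>R w" .
  moreover have "1 + \<epsilon> / (1 - \<epsilon>) = 1 / (1 - \<epsilon>)" using e1 by (simp add: field_simps)
  ultimately show ?thesis using that[of w "\<epsilon> / (1 - \<epsilon>)"] w0 e1 \<open>\<epsilon> \<noteq> 0\<close> by simp
qed

text \<open>By \<open>C_Q_F\<close>, F x = x implies x = 0, so w = (I - F) x is solvable. Then F x =
  \<nu> w and x = (1 + \<nu>) w, and applying X (I - \<Theta>) to x gives an eigenvector of
  E.\<close>

lemma eigenpair_to_E:
  assumes w: "w \<noteq> 0" "C *v (w - Q *v w) = \<nu> *\<^sub>R w" and "\<nu> \<noteq> 0"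
  obtains v where "v \<noteq> 0" "1 + \<nu> \<noteq> 0" "E *v v = (\<nu> / (1 + \<nu>)) *\<^sub>R v"
proof -
  have "x = 0" if "(mat 1 - F) *v x = 0" for x
  proof -
    have "x - F *v x = 0" using that by (simp add: matrix_vector_mult_diff_rdistrib)
    then show ?thesis using C_Q_F[of x] by simp
  qed
  then have "inj ((*v) (mat 1 - F))"
    using matrix_left_invertible_ker matrix_left_invertible_injective by blast
  then have "surj ((*v) (mat 1 - F))"
    using linear_injective_imp_surjective[OF matrix_vector_mul_linear] by blast
  then obtain x where "(mat 1 - F) *v x = w" by (metis surjD)
  then have wx: "w = x - F *v x" by (simp add: matrix_vector_mult_diff_rdistrib)
  have Fx: "F *v x = \<nu> *\<^sub>R w" using C_Q_F[of x] w(2) by (simp add: wx)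
  have x: "x = (1 + \<nu>) *\<^sub>R w" using wx by (simp add: Fx scaleR_add_left eq_diff_eq)
  have x0: "x \<noteq> 0" using wx w(1) by auto
  then have n1: "1 + \<nu> \<noteq> 0" using x by auto
  have Fx': "F *v x = (\<nu> / (1 + \<nu>)) *\<^sub>R x" using n1 by (simp add: Fx) (simp add: x)
  define v where "v = X *v (x - \<Theta> *v x)"
  have Yv: "Y *v v = (\<nu> / (1 + \<nu>)) *\<^sub>R x" using Fx' by (simp add: F_vec v_def)
  then have "v \<noteq> 0" using x0 n1 \<open>\<nu> \<noteq> 0\<close> by auto
  moreover have "E *v v = (\<nu> / (1 + \<nu>)) *\<^sub>R v"
    unfolding E_vec Yv by (simp add: matrix_vector_mult_scaleR v_def flip: scaleR_diff_right)
  ultimately show ?thesis using that n1 by blast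
qed

text \<open>\<open>c\<close> and \<open>s\<close> are the denominator and the numerator of the
  Rayleigh quotient whose extreme values are the extremal eigenvalues of C (I - Q). Writing it with
  C x in the numerator avoids inverting C, which may be singular.\<close>

definition c :: "real^'n \<Rightarrow> real" where "c x = (N *v (C *v x)) \<bullet> x"

definition s :: "real^'n \<Rightarrow> real" where
  "s x = (N *v (C *v x)) \<bullet> (C *v x) - (N *v (Q *v (C *v x))) \<bullet> (C *v x)"

text \<open>The quotient takes the value \<nu> at x = (I - Q) w, since C x = \<nu> w.\<close>

lemma eigenvalue_rayleigh:
  assumes w: "w \<noteq> 0" "C *v (w - Q *v w) = \<nu> *\<^sub>R w" and "\<nu> \<noteq> 0"
  obtains x where "c x > 0" "s x = \<nu> * c x"
proof -
  define x where "x = w - Q *v w"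
  have Cx: "C *v x = \<nu> *\<^sub>R w" using w by (simp add: x_def)
  have "C *v x \<noteq> 0" using Cx w \<open>\<nu> \<noteq> 0\<close> by simp
  then have "c x > 0" using NC_pos by (simp add: c_def)
  moreover have "s x = \<nu> * ((N *v x) \<bullet> (C *v x))"
    by (simp add: s_def x_def[symmetric] Cx matrix_vector_mult_scaleR)
      (simp add: x_def matrix_vector_mult_diff_distrib inner_diff_left algebra_simps)
  moreover have "(N *v x) \<bullet> (C *v x) = c x" by (simp add: c_def N_inner)
  ultimately show ?thesis using that by simp
qed

text \<open>The eigenvalues \<nu> lie between - \<gamma> > -1 and \<beta>, where \<nu> / (1 + \<nu>)
  is increasing, so the largest modulus is bounded by the values at the two ends.\<close>

lemma norm_upper:
  assumes upper: "\<And>x. s x \<le> \<beta> * c x" and lower: "\<And>x. - \<gamma> * c x \<le> s x"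
    and "\<beta> \<ge> 0" "\<gamma> \<ge> 0" "\<gamma> < 1"
  shows "mnorm A E \<le> max (\<beta> / (1 + \<beta>)) (\<gamma> / (1 - \<gamma>))"
proof (rule mnorm_le_if_eigenvalues_le[OF spd_A transpose_AE])
  fix \<epsilon> v assume v: "v \<noteq> 0" "E *v v = \<epsilon> *\<^sub>R v"
  show "\<bar>\<epsilon>\<bar> \<le> max (\<beta> / (1 + \<beta>)) (\<gamma> / (1 - \<gamma>))"
  proof (cases "\<epsilon> = 0")
    case True
    then show ?thesis using assms by (simp add: le_max_iff_disj)
  next
    case False
    from eigenpair_from_E[OF v False] obtain w \<nu> where w: "w \<noteq> 0" "\<nu> \<noteq> 0"
      "C *v (w - Q *v w) = \<nu> *\<^sub>R w" and e: "\<epsilon> = \<nu> / (1 + \<nu>)" by metis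
    from eigenvalue_rayleigh[OF w(1,3,2)] obtain x where x: "c x > 0" "s x = \<nu> * c x" by metis
    have "\<nu> * c x \<le> \<beta> * c x" "- \<gamma> * c x \<le> \<nu> * c x" using upper[of x] lower[of x] x by simp_all
    then have \<nu>: "\<nu> \<le> \<beta>" "- \<gamma> \<le> \<nu>" using x(1) mult_le_cancel_right_pos by blast+
    show ?thesis
    proof (cases "\<nu> \<ge> 0")
      case True
      then have "\<bar>\<epsilon>\<bar> \<le> \<beta> / (1 + \<beta>)" using \<nu> assms by (simp add: e field_simps)
      then show ?thesis by simp
    next
      case False
      then have "\<bar>\<epsilon>\<bar> = - \<nu> / (1 + \<nu>)" using \<nu> assms by (simp add: e abs_div)
      also have "\<dots> \<le> \<gamma> / (1 - \<gamma>)" using False \<nu> assms by (simp add: field_simps)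
      finally show ?thesis by simp
    qed
  qed
qed

text \<open>The sign \<sigma> selects the maximum or the minimum of s / c. Both come from
  \<open>psd_pencil_maximizer\<close> with J = N C.\<close>

lemma extremal_eigenpair:
  assumes "c x\<^sub>0 > 0" "\<sigma> \<in> {1, - 1}"
  obtains w \<nu> where "w \<noteq> 0" "C *v (w - Q *v w) = \<nu> *\<^sub>R w" "\<And>x. \<sigma> * s x \<le> \<sigma> * \<nu> * c x"
proof -
  \<comment> \<open>Symmetric because N Q is; with J = N C the form of J S J is \<sigma> times
    \<open>s\<close>.\<close>
  define S where "S = \<sigma> *\<^sub>R ((mat 1 - Q) ** matrix_inv N)"
  have SN: "S *v (N *v y) = \<sigma> *\<^sub>R (y - Q *v y)" for y
    by (simp add: S_def matrix_vector_mult_diff_rdistrib matrix_inv_cancel spd_invertible[OF spd_N]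
        flip: matrix_vector_mul_assoc scaleR_matrix_vector_assoc)
  have SN_inner: "(S *v (N *v y)) \<bullet> (N *v z) = \<sigma> * ((N *v y) \<bullet> z - (N *v (Q *v y)) \<bullet> z)" for y z
    using N_inner[of y z] N_inner[of "Q *v y" z] by (simp add: SN inner_diff_right inner_commute[of "_ - _"] inner_commute)
  have "transpose S = S"
  proof (rule symmetricI)
    fix x y
    obtain x' y' where "x = N *v x'" "y = N *v y'" by (metis matrix_inv_cancel(1) spd_N spd_invertible)
    then show "(S *v x) \<bullet> y = (S *v y) \<bullet> x"
      using NQ_inner[of x' y'] N_inner[of x' y'] by (simp add: SN_inner)
  qed
  moreover have "N ** C \<noteq> 0" using assms(1) by (auto simp: c_def simp flip: NC_vec)
  ultimately obtain u \<nu> where u: "N *v (C *v u) \<noteq> 0"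
    "N *v (C *v (S *v (N *v (C *v u)))) = \<nu> *\<^sub>R (N *v (C *v u))"
    "\<And>x. (S *v (N *v (C *v x))) \<bullet> (N *v (C *v x)) \<le> \<nu> * ((N *v (C *v x)) \<bullet> x)"
    using psd_pencil_maximizer[OF _ transpose_NC, unfolded NC_vec, OF _ NC_nonneg] by metis
  define w where "w = C *v u"
  have "w \<noteq> 0" using u(1) by (auto simp: w_def)
  moreover have "C *v (\<sigma> *\<^sub>R (w - Q *v w)) = \<nu> *\<^sub>R w"
    by (rule N_cancel) (use u(2) in \<open>simp add: SN w_def matrix_vector_mult_scaleR\<close>)
  then have "C *v (w - Q *v w) = (\<sigma> * \<nu>) *\<^sub>R w"
    using assms(2) by (auto simp: matrix_vector_mult_scaleR minus_equation_iff)
  moreover have "\<sigma> * s x \<le> \<sigma> * (\<sigma> * \<nu>) * c x" for x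
    using u(3)[of x] assms(2) by (auto simp: SN_inner s_def c_def)
  ultimately show ?thesis using that by blast
qed

text \<open>A single trial vector forces the largest \<nu> to be at least \<beta>, and \<nu> / (1 +
  \<nu>) is increasing for \<nu> \<ge> 0.\<close>

lemma norm_lower_top:
  assumes "c x > 0" "\<beta> \<ge> 0" "\<beta> * c x \<le> s x"
  shows "\<beta> / (1 + \<beta>) \<le> mnorm A E"
proof (cases "\<beta> = 0")
  case False
  from extremal_eigenpair[OF assms(1), of 1] obtain w \<nu> where w: "w \<noteq> 0" "C *v (w - Q *v w) = \<nu> *\<^sub>R w"
    and le: "\<And>x. s x \<le> \<nu> * c x" by auto
  have "\<beta> * c x \<le> \<nu> * c x" using assms(3) le[of x] by simp
  then have \<nu>: "\<beta> \<le> \<nu>" using assms(1) by simp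
  then have "\<nu> \<noteq> 0" using assms(2) False by simp
  from eigenpair_to_E[OF w this] obtain v where "v \<noteq> 0" "E *v v = (\<nu> / (1 + \<nu>)) *\<^sub>R v" by metis
  then have "\<bar>\<nu> / (1 + \<nu>)\<bar> \<le> mnorm A E" by (rule abs_eigenvalue_le_mnorm[OF spd_A])
  moreover have "\<beta> / (1 + \<beta>) \<le> \<nu> / (1 + \<nu>)" using \<nu> assms(2) by (simp add: field_simps)
  ultimately show ?thesis by linarith
qed (simp add: mnorm_nonneg[OF spd_A])

text \<open>The trial vector forces the smallest \<nu> below - \<beta>, while the bound with
  \<gamma> < 1 keeps it above -1, where the modulus of \<nu> / (1 + \<nu>) grows as \<nu> decreases
  through negative values.\<close>

lemma norm_lower_bottom:
  assumes "c x > 0" "\<beta> \<ge> 0" "s x \<le> - \<beta> * c x"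
    and lower: "\<And>x. - \<gamma> * c x \<le> s x" and "\<gamma> < 1"
  shows "\<beta> / (1 - \<beta>) \<le> mnorm A E"
proof (cases "\<beta> = 0")
  case False
  from extremal_eigenpair[OF assms(1), of "- 1"] obtain w \<nu> where w: "w \<noteq> 0" "C *v (w - Q *v w) = \<nu> *\<^sub>R w"
    and le: "\<And>x. \<nu> * c x \<le> s x" by auto
  have "\<nu> * c x \<le> - \<beta> * c x" using assms(3) le[of x] by simp
  then have \<nu>: "\<nu> \<le> - \<beta>" using assms(1) mult_le_cancel_right_pos by blast
  then have n0: "\<nu> \<noteq> 0" using assms(2) False by simp
  from eigenvalue_rayleigh[OF w n0] obtain y where y: "c y > 0" "s y = \<nu> * c y" by metis
  have "- \<gamma> * c y \<le> \<nu> * c y" using lower[of y] y by simp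
  then have "- \<gamma> \<le> \<nu>" using y(1) mult_le_cancel_right_pos by blast
  then have \<nu>1: "\<nu> > - 1" using \<open>\<gamma> < 1\<close> by simp
  from eigenpair_to_E[OF w n0] obtain v where "v \<noteq> 0" "E *v v = (\<nu> / (1 + \<nu>)) *\<^sub>R v" by metis
  then have "\<bar>\<nu> / (1 + \<nu>)\<bar> \<le> mnorm A E" by (rule abs_eigenvalue_le_mnorm[OF spd_A])
  moreover have "\<bar>\<nu> / (1 + \<nu>)\<bar> = - \<nu> / (1 + \<nu>)" using \<nu> \<nu>1 assms(2) by (simp add: abs_div)
  moreover have "\<beta> / (1 - \<beta>) \<le> - \<nu> / (1 + \<nu>)" using \<nu> \<nu>1 assms(2) by (simp add: field_simps)
  ultimately show ?thesis by simp
qed (simp add: mnorm_nonneg[OF spd_A])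

end

section \<open>Bounds on the energy norm\<close>

lemma one_minus_inverse: "b \<ge> 1 \<Longrightarrow> (b - 1) / (1 + (b - 1)) = 1 - 1 / (b::real)"
  by (simp add: field_simps)

text \<open>R is the exact coarse projection. \<open>R_range\<close> and \<open>R_ker\<close> record
  that the coarse space is neither zero nor everything.\<close>

locale inexact_two_grid_bounds = inexact_two_grid A N X Y \<Theta> Q
  for A N X Y \<Theta> Q :: "real^'n^'n" +
  fixes R :: "real^'n^'n" and \<delta>\<^sub>1 \<delta>\<^sub>2 :: real
  assumes R_idem: "\<And>v. R *v (R *v v) = R *v v"
    and R_inner: "\<And>x y. (N *v (R *v x)) \<bullet> y = (N *v (R *v y)) \<bullet> x"
    and R_range: "\<exists>z. z \<noteq> 0 \<and> R *v z = z"
    and R_ker: "\<exists>z. z \<noteq> 0 \<and> R *v z = 0"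
    and Q_lower: "\<And>y. \<delta>\<^sub>1 * ((N *v (R *v y)) \<bullet> y) \<le> (N *v (Q *v y)) \<bullet> y"
    and Q_upper: "\<And>y. (N *v (Q *v y)) \<bullet> y \<le> \<delta>\<^sub>2 * ((N *v (R *v y)) \<bullet> y)"
    and delta_pos: "0 < \<delta>\<^sub>1" "0 < \<delta>\<^sub>2"
begin

definition lmax :: real where "lmax = lambda_max (matrix_inv A ** N)"
definition lmin :: real where "lmin = lambda_min (matrix_inv A ** N)"
definition lR :: real where "lR = lambda_max (matrix_inv A ** (N ** R))"
text \<open>This eigenvalue coincides with \<open>K_TG\<close>, since I - R is an N-orthogonal
  projection.\<close>

definition K :: real where "K = lambda_max (matrix_inv A ** (N ** (mat 1 - R)))"

text \<open>\<open>n\<close> and \<open>p\<close> are the squared N-norms of C x and of its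
  projection R C x. All estimates of \<open>s\<close> come from comparing combinations of them with
  \<open>c\<close>.\<close>

definition n :: "real^'n \<Rightarrow> real" where "n x = (N *v (C *v x)) \<bullet> (C *v x)"
definition p :: "real^'n \<Rightarrow> real" where "p x = (N *v (R *v (C *v x))) \<bullet> (C *v x)"

section \<open>Quotients of the identity, the projection and its complement\<close>

lemma complement_vec: "(mat 1 - R) *v x = x - R *v x"
  by (simp add: matrix_vector_mult_diff_rdistrib)

lemma complement_idem: "(mat 1 - R) *v ((mat 1 - R) *v v) = (mat 1 - R) *v v"
  by (simp add: complement_vec matrix_vector_mult_diff_distrib R_idem)

lemma complement_inner: "(N *v ((mat 1 - R) *v x)) \<bullet> y = (N *v ((mat 1 - R) *v y)) \<bullet> x"
  using R_inner[of x y] N_inner[of x y]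
  by (simp add: complement_vec matrix_vector_mult_diff_distrib inner_diff_left)

lemma complement_range: "\<exists>z. z \<noteq> 0 \<and> (mat 1 - R) *v z = z"
  using R_ker by (auto simp: complement_vec)

text \<open>Combines the projection estimates with \<kappa> as largest eigenvalue. Attainment is
  stated for \<kappa> > 1 because no vector with c z > 0 exists when C = 0.\<close>

lemma projection_pencil:
  assumes "\<exists>z. z \<noteq> 0 \<and> S *v z = z" "\<And>v. S *v (S *v v) = S *v v"
    "\<And>x y. (N *v (S *v x)) \<bullet> y = (N *v (S *v y)) \<bullet> x"
    and "\<kappa> = lambda_max (matrix_inv A ** (N ** S))"
  shows "\<kappa> \<ge> 1" "(N *v (S *v (C *v x))) \<bullet> (C *v x) \<le> (\<kappa> - 1) * c x"
    "\<kappa> > 1 \<Longrightarrow> \<exists>z. c z > 0 \<and> (N *v (S *v (C *v z))) \<bullet> (C *v z) = (\<kappa> - 1) * c z"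
proof -
  have "transpose (N ** S) = N ** S"
    by (rule symmetricI) (use assms(3) in \<open>simp add: matrix_vector_mul_assoc\<close>)
  from lambda_max_pencil[OF spd_A this]
  obtain u where u: "u \<noteq> 0" "N *v (S *v u) = \<kappa> *\<^sub>R (A *v u)"
    "\<And>x. (N *v (S *v x)) \<bullet> x \<le> \<kappa> * ((A *v x) \<bullet> x)"
    unfolding assms(4) matrix_vector_mul_assoc by metis
  note facts = assms(1-3) u(3)
  show "\<kappa> \<ge> 1" by (rule projection_kappa_ge_1[OF facts])
  show "(N *v (S *v (C *v x))) \<bullet> (C *v x) \<le> (\<kappa> - 1) * c x"
    unfolding c_def by (rule projection_upper[OF facts])
  show "\<exists>z. c z > 0 \<and> (N *v (S *v (C *v z))) \<bullet> (C *v z) = (\<kappa> - 1) * c z" if "\<kappa> > 1"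
    unfolding c_def using projection_upper_attained[OF facts that u(1,2)] by metis
qed

lemma lmax_bound: "lmax \<ge> 1" "n x \<le> (lmax - 1) * c x"
    "lmax > 1 \<Longrightarrow> \<exists>z. c z > 0 \<and> n z = (lmax - 1) * c z"
proof -
  have "\<exists>z::real^'n. z \<noteq> 0" using R_range by blast
  then show "lmax \<ge> 1" "n x \<le> (lmax - 1) * c x"
    "lmax > 1 \<Longrightarrow> \<exists>z. c z > 0 \<and> n z = (lmax - 1) * c z"
    using projection_pencil[of "mat 1" lmax] N_inner by (simp_all add: lmax_def n_def)
qed

lemma lR_bound: "lR \<ge> 1" "p x \<le> (lR - 1) * c x"
    "lR > 1 \<Longrightarrow> \<exists>z. c z > 0 \<and> p z = (lR - 1) * c z"
  using projection_pencil[OF R_range R_idem R_inner lR_def] by (simp_all add: p_def)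

lemma n_minus_p: "n x - p x = (N *v ((mat 1 - R) *v (C *v x))) \<bullet> (C *v x)"
  by (simp add: n_def p_def complement_vec matrix_vector_mult_diff_distrib inner_diff_left)

lemma K_bound: "K \<ge> 1" "n x - p x \<le> (K - 1) * c x"
    "K > 1 \<Longrightarrow> \<exists>z. c z > 0 \<and> n z - p z = (K - 1) * c z"
  using projection_pencil[OF complement_range complement_idem complement_inner K_def]
  by (simp_all add: n_minus_p)

text \<open>Pythagoras: n - p is the squared N-norm of (I - R) C x.\<close>

lemma p_le_n: "0 \<le> p x" "p x \<le> n x"
proof -
  show "0 \<le> p x"
    using spd_nonneg[OF spd_N, of "R *v (C *v x)"] projection_quadratic[OF R_range R_idem R_inner]
    by (metis R_idem R_inner p_def)
  have "0 \<le> n x - p x"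
    using spd_nonneg[OF spd_N, of "(mat 1 - R) *v (C *v x)"]
    by (metis complement_idem complement_inner n_minus_p)
  then show "p x \<le> n x" by simp
qed

lemma lmin_bound: "lmin \<ge> 1" "(lmin - 1) * c x \<le> n x"
    "lmin > 1 \<Longrightarrow> z \<noteq> 0 \<Longrightarrow> \<exists>x. c x > 0 \<and> C *v x = z"
proof -
  from lambda_min_pencil[OF spd_A spd_sym[OF spd_N]]
  obtain u where u: "u \<noteq> 0" "N *v u = lmin *\<^sub>R (A *v u)"
    "\<And>x. lmin * ((A *v x) \<bullet> x) \<le> (N *v x) \<bullet> x" unfolding lmin_def by metis
  have "(A *v u) \<bullet> u \<le> lmin * ((A *v u) \<bullet> u)" using A_le_N[of u] u by simp
  then show 1: "lmin \<ge> 1" using spd_pos[OF spd_A u(1)] by simp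
  show "(lmin - 1) * c x \<le> n x" using NCC_lower[OF 1 u(3)] by (simp add: n_def c_def)
  show "\<exists>x. c x > 0 \<and> C *v x = z" if "lmin > 1" "z \<noteq> 0"
    unfolding c_def using C_surjective[OF that(1) u(3)] NC_pos that(2) by metis
qed

section \<open>Two-sided bounds on \<open>s\<close>\<close>

lemma s_bounds: "n x - \<delta>\<^sub>2 * p x \<le> s x" "s x \<le> n x - \<delta>\<^sub>1 * p x"
  using Q_lower[of "C *v x"] Q_upper[of "C *v x"] by (simp_all add: s_def n_def p_def)

text \<open>For \<open>\<delta>\<^sub>1 \<le> 1\<close> the upper bound
  \<open>n x - \<delta>\<^sub>1 * p x\<close> is a convex combination of n - p and n.\<close>

lemma s_upper_convex:
  assumes "\<delta>\<^sub>1 \<le> 1"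
  shows "s x \<le> (\<delta>\<^sub>1 * K + (1 - \<delta>\<^sub>1) * lmax - 1) * c x" "\<delta>\<^sub>1 * K + (1 - \<delta>\<^sub>1) * lmax \<ge> 1"
proof -
  have "n x - \<delta>\<^sub>1 * p x = \<delta>\<^sub>1 * (n x - p x) + (1 - \<delta>\<^sub>1) * n x" by (simp add: algebra_simps)
  also have "\<dots> \<le> \<delta>\<^sub>1 * ((K - 1) * c x) + (1 - \<delta>\<^sub>1) * ((lmax - 1) * c x)"
    using assms delta_pos K_bound(2)[of x] lmax_bound(2)[of x] by (intro add_mono mult_left_mono) auto
  finally show "s x \<le> (\<delta>\<^sub>1 * K + (1 - \<delta>\<^sub>1) * lmax - 1) * c x"
    using s_bounds(2)[of x] by (simp add: algebra_simps)
  have "\<delta>\<^sub>1 * 1 + (1 - \<delta>\<^sub>1) * 1 \<le> \<delta>\<^sub>1 * K + (1 - \<delta>\<^sub>1) * lmax"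
    using assms delta_pos K_bound(1) lmax_bound(1) by (intro add_mono mult_left_mono) auto
  then show "\<delta>\<^sub>1 * K + (1 - \<delta>\<^sub>1) * lmax \<ge> 1" by simp
qed

lemma s_upper_K:
  assumes "1 < \<delta>\<^sub>1"
  shows "s x \<le> (K - 1) * c x"
proof -
  have "p x \<le> \<delta>\<^sub>1 * p x" using assms p_le_n(1)[of x] by (simp add: mult_le_cancel_right1)
  then show ?thesis using s_bounds(2)[of x] K_bound(2)[of x] by simp
qed

text \<open>Replacing n by the smaller p leaves \<open>- (\<delta>\<^sub>2 - 1) * p x\<close>, which
  \<open>lR\<close> controls.\<close>

lemma s_lower:
  assumes "\<gamma> = (\<delta>\<^sub>2 - 1) * (lR - 1)" "1 < \<delta>\<^sub>2"
  shows "- \<gamma> * c x \<le> s x"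
proof -
  have "(\<delta>\<^sub>2 - 1) * p x \<le> (\<delta>\<^sub>2 - 1) * ((lR - 1) * c x)"
    using assms lR_bound(2) by (intro mult_left_mono) auto
  then show ?thesis using s_bounds(1)[of x] p_le_n(2)[of x] by (simp add: assms(1) algebra_simps)
qed

lemma s_nonneg:
  assumes "\<delta>\<^sub>2 \<le> 1"
  shows "0 \<le> s x"
proof -
  have "\<delta>\<^sub>2 * p x \<le> p x" using assms p_le_n(1)[of x] by (simp add: mult_left_le_one_le delta_pos(2) less_imp_le)
  then show ?thesis using s_bounds(1)[of x] p_le_n(2)[of x] by simp
qed

text \<open>Clearing the denominator for lR > 1; for lR = 1 the product vanishes. The result is the
  condition \<gamma> < 1 that keeps every \<nu> above -1.\<close>

lemma quot_pred_bound:
  assumes "ereal \<delta>\<^sub>2 < quot_pred lR"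
  shows "(\<delta>\<^sub>2 - 1) * (lR - 1) < 1"
  using assms lR_bound(1) by (auto simp: quot_pred_def field_simps split: if_splits)

text \<open>Restates \<open>norm_lower_top\<close> with b = 1 + \<beta>. A trial vector is needed
  only for b > 1, as the bound is 0 at b = 1.\<close>

lemma mnorm_lower_top:
  assumes "b \<ge> 1" "b > 1 \<Longrightarrow> \<exists>x. c x > 0 \<and> (b - 1) * c x \<le> s x"
  shows "1 - 1 / b \<le> mnorm A E"
proof (cases "b > 1")
  case True
  then obtain x where "c x > 0" "(b - 1) * c x \<le> s x" using assms(2) by blast
  from norm_lower_top[OF this(1) _ this(2)] True show ?thesis by (simp add: field_simps)
next
  case False
  then show ?thesis using assms(1) mnorm_nonneg[OF spd_A] by simp
qed

lemma mnorm_lower_bottom: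
  assumes "1 < \<delta>\<^sub>2" "(\<delta>\<^sub>2 - 1) * (lR - 1) < 1"
    and "b < 1 \<Longrightarrow> \<exists>x. c x > 0 \<and> s x \<le> - (1 - b) * c x"
  shows "1 / b - 1 \<le> mnorm A E"
proof (cases "b < 1")
  case True
  then obtain x where x: "c x > 0" "s x \<le> - (1 - b) * c x" using assms(3) by blast
  have "(1 - b) / (1 - (1 - b)) \<le> mnorm A E"
    by (rule norm_lower_bottom[OF x(1) _ x(2) s_lower[OF refl assms(1)] assms(2)]) (use True in simp)
  \<comment> \<open>At b = 0 the convention 1 / 0 = 0 makes the left side -1.\<close>
  then show ?thesis using mnorm_nonneg[OF spd_A, of E] by (cases "b = 0") (auto simp: field_simps)
next
  case False
  then have "1 / b \<le> 1" by simp
  then show ?thesis using mnorm_nonneg[OF spd_A, of E] by linarith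
qed

lemma L1_bound:
  assumes "\<delta>\<^sub>2 \<le> 1"
  shows "1 - 1 / max K (lmax - \<delta>\<^sub>2 * lR + \<delta>\<^sub>2) \<le> mnorm A E"
proof (rule mnorm_lower_top)
  show "max K (lmax - \<delta>\<^sub>2 * lR + \<delta>\<^sub>2) \<ge> 1" using K_bound(1) by simp
  assume gt: "max K (lmax - \<delta>\<^sub>2 * lR + \<delta>\<^sub>2) > 1"
  show "\<exists>x. c x > 0 \<and> (max K (lmax - \<delta>\<^sub>2 * lR + \<delta>\<^sub>2) - 1) * c x \<le> s x"
  proof (cases "lmax - \<delta>\<^sub>2 * lR + \<delta>\<^sub>2 \<le> K")
    case True
    \<comment> \<open>Trial vector: the maximizer of (n - p) / c.\<close>
    then obtain z where z: "c z > 0" "n z - p z = (K - 1) * c z" using gt K_bound(3) by auto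
    have "\<delta>\<^sub>2 * p z \<le> p z" using assms p_le_n(1)[of z] by (simp add: mult_left_le_one_le delta_pos(2) less_imp_le)
    then show ?thesis using z True s_bounds(1)[of z] by (intro exI[of _ z]) simp
  next
    case False
    have "0 \<le> \<delta>\<^sub>2 * (lR - 1)" using lR_bound(1) delta_pos by simp
    then have "lmax > 1" using gt False by (simp add: algebra_simps)
    \<comment> \<open>Trial vector: the maximizer of n / c, with p bounded through
      \<open>lR\<close>.\<close>
    then obtain z where z: "c z > 0" "n z = (lmax - 1) * c z" using lmax_bound(3) by auto
    have "\<delta>\<^sub>2 * p z \<le> \<delta>\<^sub>2 * ((lR - 1) * c z)" using lR_bound(2) delta_pos by simp
    then show ?thesis using z False s_bounds(1)[of z] by (intro exI[of _ z]) (simp add: algebra_simps)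
  qed
qed

lemma L2_bound:
  assumes "1 < \<delta>\<^sub>2"
  shows "1 - 1 / max lmin (\<delta>\<^sub>2 * K + (1 - \<delta>\<^sub>2) * lmax) \<le> mnorm A E"
proof (rule mnorm_lower_top)
  let ?b = "\<delta>\<^sub>2 * K + (1 - \<delta>\<^sub>2) * lmax"
  show "max lmin ?b \<ge> 1" using lmin_bound(1) by simp
  assume gt: "max lmin ?b > 1"
  show "\<exists>x. c x > 0 \<and> (max lmin ?b - 1) * c x \<le> s x"
  proof (cases "?b \<le> lmin")
    case True
    \<comment> \<open>Trial vector: x with C x in the kernel of R, so that p x = 0.\<close>
    obtain z where z: "z \<noteq> 0" "R *v z = 0" using R_ker by blast
    obtain x where x: "c x > 0" "C *v x = z" using lmin_bound(3)[OF _ z(1)] True gt by auto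
    have "p x = 0" by (simp add: p_def x z)
    then show ?thesis using x True s_bounds(1)[of x] lmin_bound(2)[of x] by (intro exI[of _ x]) simp
  next
    case False
    have "(\<delta>\<^sub>2 - 1) * (lmax - 1) \<ge> 0" using assms lmax_bound(1) by simp
    then have "\<delta>\<^sub>2 * (K - 1) > 0" using False gt by (simp add: algebra_simps)
    then have "K > 1" using delta_pos by (simp add: zero_less_mult_iff)
    \<comment> \<open>Trial vector: the maximizer of (n - p) / c, used with \<open>n z -
      \<delta>\<^sub>2 * p z = \<delta>\<^sub>2 * (n z - p z) - (\<delta>\<^sub>2 - 1) * n
      z\<close>.\<close>
    then obtain z where z: "c z > 0" "n z - p z = (K - 1) * c z" using K_bound(3) by auto
    have "(\<delta>\<^sub>2 - 1) * n z \<le> (\<delta>\<^sub>2 - 1) * ((lmax - 1) * c z)"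
      using lmax_bound(2) assms by (intro mult_left_mono) auto
    moreover have "\<delta>\<^sub>2 * (n z - p z) = \<delta>\<^sub>2 * ((K - 1) * c z)" by (simp only: z(2))
    ultimately have "(?b - 1) * c z \<le> n z - \<delta>\<^sub>2 * p z" by (simp add: algebra_simps)
    then show ?thesis using z False s_bounds(1)[of z] by (intro exI[of _ z]) simp
  qed
qed

lemma L3_bound:
  assumes "1 < \<delta>\<^sub>1" "1 < \<delta>\<^sub>2" "(\<delta>\<^sub>2 - 1) * (lR - 1) < 1"
  shows "1 / (min (lmax - \<delta>\<^sub>1 * lR) ((1 - \<delta>\<^sub>1) * lmin) + \<delta>\<^sub>1) - 1 \<le> mnorm A E"
proof (rule mnorm_lower_bottom[OF assms(2,3)])
  let ?a = "lmax - \<delta>\<^sub>1 * lR" and ?b = "(1 - \<delta>\<^sub>1) * lmin"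
  assume lt: "min ?a ?b + \<delta>\<^sub>1 < 1"
  show "\<exists>x. c x > 0 \<and> s x \<le> - (1 - (min ?a ?b + \<delta>\<^sub>1)) * c x"
  proof (cases "?a \<le> ?b")
    case True
    then have "\<delta>\<^sub>1 * (lR - 1) > 0" using lt lmax_bound(1) by (simp add: algebra_simps)
    then have "lR > 1" using delta_pos by (simp add: zero_less_mult_iff)
    \<comment> \<open>Trial vector: the maximizer of p / c, with n bounded through
      \<open>lmax\<close>.\<close>
    then obtain z where z: "c z > 0" "p z = (lR - 1) * c z" using lR_bound(3) by auto
    have "n z - \<delta>\<^sub>1 * p z \<le> - (1 - (?a + \<delta>\<^sub>1)) * c z"
      using lmax_bound(2)[of z] by (simp add: z(2) algebra_simps)
    then show ?thesis using z True s_bounds(2)[of z] by (intro exI[of _ z]) simp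
  next
    case False
    then have "(\<delta>\<^sub>1 - 1) * (lmin - 1) > 0" using lt by (simp add: algebra_simps)
    then have "lmin > 1" using assms by (simp add: zero_less_mult_iff)
    \<comment> \<open>Trial vector: x with C x in the range of R, so that p x = n x.\<close>
    obtain z where z: "z \<noteq> 0" "R *v z = z" using R_range by blast
    obtain x where x: "c x > 0" "C *v x = z" using lmin_bound(3)[OF \<open>lmin > 1\<close> z(1)] by auto
    have "p x = n x" by (simp add: p_def n_def x z)
    moreover have "(\<delta>\<^sub>1 - 1) * ((lmin - 1) * c x) \<le> (\<delta>\<^sub>1 - 1) * n x"
      using assms lmin_bound(2) by (intro mult_left_mono) auto
    ultimately have "n x - \<delta>\<^sub>1 * p x \<le> - (1 - (?b + \<delta>\<^sub>1)) * c x" by (simp add: algebra_simps)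
    then show ?thesis using x False s_bounds(2)[of x] by (intro exI[of _ x]) simp
  qed
qed

section \<open>Upper bounds on the norm\<close>

lemma gamma_quotient:
  assumes "(\<delta>\<^sub>2 - 1) * (lR - 1) < 1"
  shows "((\<delta>\<^sub>2 - 1) * (lR - 1)) / (1 - (\<delta>\<^sub>2 - 1) * (lR - 1)) = 1 / ((1 - \<delta>\<^sub>2) * lR + \<delta>\<^sub>2) - 1"
proof -
  have "(1 - \<delta>\<^sub>2) * lR + \<delta>\<^sub>2 = 1 - (\<delta>\<^sub>2 - 1) * (lR - 1)" by (simp add: algebra_simps)
  moreover have "t / (1 - t) = 1 / (1 - t) - 1" if "t < 1" for t :: real using that by (simp add: field_simps)
  ultimately show ?thesis using assms by simp
qed

text \<open>\<open>norm_upper\<close> with \<gamma> = 0, since \<open>s\<close> is nonnegative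
  here.\<close>

lemma U1_bound:
  assumes "\<delta>\<^sub>1 \<le> 1" "\<delta>\<^sub>2 \<le> 1"
  shows "mnorm A E \<le> 1 - 1 / (\<delta>\<^sub>1 * K + (1 - \<delta>\<^sub>1) * lmax)"
proof -
  let ?b = "\<delta>\<^sub>1 * K + (1 - \<delta>\<^sub>1) * lmax"
  have "mnorm A E \<le> max ((?b - 1) / (1 + (?b - 1))) (0 / (1 - 0))"
    by (rule norm_upper) (use s_upper_convex[OF assms(1)] s_nonneg[OF assms(2)] in auto)
  then show ?thesis using s_upper_convex(2)[OF assms(1)] one_minus_inverse[of ?b] by simp
qed

lemma U1_U2_bound:
  assumes "\<delta>\<^sub>1 \<le> 1" "1 < \<delta>\<^sub>2" "(\<delta>\<^sub>2 - 1) * (lR - 1) < 1"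
  shows "mnorm A E \<le> max (1 - 1 / (\<delta>\<^sub>1 * K + (1 - \<delta>\<^sub>1) * lmax)) (1 / ((1 - \<delta>\<^sub>2) * lR + \<delta>\<^sub>2) - 1)"
  unfolding gamma_quotient[OF assms(3), symmetric] one_minus_inverse[OF s_upper_convex(2)[OF assms(1)], symmetric]
  by (rule norm_upper)
    (use s_upper_convex[OF assms(1)] s_lower[OF refl assms(2)] assms lR_bound(1) in auto)

lemma U3_bound:
  assumes "1 < \<delta>\<^sub>1" "1 < \<delta>\<^sub>2" "(\<delta>\<^sub>2 - 1) * (lR - 1) < 1"
  shows "mnorm A E \<le> max (1 - 1 / K) (1 / ((1 - \<delta>\<^sub>2) * lR + \<delta>\<^sub>2) - 1)"
  unfolding gamma_quotient[OF assms(3), symmetric] one_minus_inverse[OF K_bound(1), symmetric]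
  by (rule norm_upper)
    (use s_upper_K[OF assms(1)] K_bound(1) s_lower[OF refl assms(2)] assms lR_bound(1) in auto)

end

section \<open>The concrete smoother and coarse space\<close>

lemma spd_Mtilde:
  assumes "invertible M" "spd (M + transpose M - A)"
  shows "spd (Mtilde A M)"
  unfolding Mtilde_def
  by (intro spd_congruence spd_inverse assms inj_matrix_vector_mult)

lemma Mtilde_vec: "Mtilde A M *v v = transpose M *v (matrix_inv (M + transpose M - A) *v (M *v v))"
  by (simp add: Mtilde_def matrix_vector_mul_assoc matrix_mul_assoc)

text \<open>Completing the square: with W = M + M^T - A and g = W^-1 M v, the difference of the two
  forms is the form of W at v - g.\<close>

lemma A_le_Mtilde:
  assumes "spd A" and W: "spd (M + transpose M - A)"
  shows "(A *v v) \<bullet> v \<le> (Mtilde A M *v v) \<bullet> v"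
proof -
  let ?W = "M + transpose M - A"
  define g where "g = matrix_inv ?W *v (M *v v)"
  have Wg: "?W *v g = M *v v" by (simp add: g_def matrix_inv_cancel spd_invertible[OF W])
  have Mt: "(transpose M *v x) \<bullet> y = (M *v y) \<bullet> x" for x y
    using inner_matrix_transpose[of M y x] by (simp add: inner_commute)
  have Nv: "(Mtilde A M *v v) \<bullet> v = (?W *v g) \<bullet> g"
    by (simp add: Mtilde_vec Mt Wg flip: g_def)
  have Wv: "(?W *v v) \<bullet> v = 2 * ((M *v v) \<bullet> v) - (A *v v) \<bullet> v"
    by (simp add: matrix_vector_mult_diff_rdistrib matrix_vector_mult_add_rdistrib inner_simps Mt)
  have "0 \<le> (?W *v (v - g)) \<bullet> (v - g)" by (rule spd_nonneg[OF W])
  also have "\<dots> = (?W *v v) \<bullet> v - 2 * ((?W *v g) \<bullet> v) + (?W *v g) \<bullet> g"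
    using symmetric_inner[OF spd_sym[OF W], of v g]
    by (simp add: matrix_vector_mult_diff_distrib inner_diff_left inner_diff_right)
  also have "\<dots> = (Mtilde A M *v v) \<bullet> v - (A *v v) \<bullet> v"
    by (simp only: Wv Nv) (simp add: Wg)
  finally show ?thesis by simp
qed

text \<open>\<open>Mtilde A M\<close> is the symmetrized smoother: sweeping with M^T and then with M
  has the error operator I - N^-1 A.\<close>

lemma Mtilde_smoother:
  assumes "invertible M" and W: "spd (M + transpose M - A)"
  shows "Mtilde A M *v ((mat 1 - matrix_inv M ** A) *v ((mat 1 - transpose (matrix_inv M) ** A) *v v))
    = Mtilde A M *v v - A *v v"
proof -
  let ?W = "M + transpose M - A"
  let ?N = "Mtilde A M"
  have Mti: "transpose M *v (transpose (matrix_inv M) *v x) = x"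
    "transpose (matrix_inv M) *v (transpose M *v x) = x" for x
    using matrix_inv_inverse[OF assms(1)]
    by (metis matrix_transpose_mul transpose_mat matrix_vector_mul_assoc matrix_vector_mul_lid)+
  define t where "t = transpose (matrix_inv M) *v (A *v v)"
  have Mt: "transpose M *v t = A *v v" by (simp add: t_def Mti)
  define r where "r = v - t"
  have r: "(mat 1 - transpose (matrix_inv M) ** A) *v v = r"
    by (simp add: r_def t_def matrix_vector_mult_diff_rdistrib flip: matrix_vector_mul_assoc)
  have "(mat 1 - matrix_inv M ** A) *v r = r - matrix_inv M *v (A *v r)"
    by (simp add: matrix_vector_mult_diff_rdistrib flip: matrix_vector_mul_assoc)
  then have "M *v ((mat 1 - matrix_inv M ** A) *v r) = M *v r - A *v r"
    by (simp add: matrix_vector_mult_diff_distrib matrix_inv_cancel assms(1))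
  \<comment> \<open>Here A v = M^T t is substituted, so that W appears and cancels against the W^-1
    inside \<open>Mtilde\<close>.\<close>
  also have "\<dots> = M *v v - ?W *v t"
    by (simp add: r_def matrix_vector_mult_diff_distrib matrix_vector_mult_diff_rdistrib
        matrix_vector_mult_add_rdistrib Mt)
  finally have "?N *v ((mat 1 - matrix_inv M ** A) *v r) = ?N *v v - transpose M *v t"
    by (simp add: Mtilde_vec matrix_vector_mult_diff_distrib matrix_inv_cancel spd_invertible[OF W])
  then show ?thesis by (simp add: r Mt)
qed

theorem theorem3p4:
  fixes A M :: "real^'n^'n" and P :: "real^'c^'n" and Bc :: "real^'c^'c"
  assumes "spd A"
    and "invertible M"
    and "spd (M + transpose M - A)"
    and "CARD('c) < CARD('n)"
    and "rank P = CARD('c)"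
    and "spd Bc"
  shows
    "let normE = mnorm A (E_ITG A M P Bc);
         K = K_TG A M P;
         \<delta>1 = d1 A M P Bc;
         \<delta>2 = d2 A M P Bc;
         lmax = lambda_max (matrix_inv A ** Mtilde A M);
         lmin = lambda_min (matrix_inv A ** Mtilde A M);
         lPi = lambda_max (matrix_inv A ** Mtilde A M ** Pi_proj (Mtilde A M) P);
         L1 = 1 - 1 / max K (lmax - \<delta>2 * lPi + \<delta>2);
         U1 = 1 - 1 / (\<delta>1 * K + (1 - \<delta>1) * lmax);
         L2 = 1 - 1 / max lmin (\<delta>2 * K + (1 - \<delta>2) * lmax);
         U2 = 1 / ((1 - \<delta>2) * lPi + \<delta>2) - 1;
         L3 = 1 / (min (lmax - \<delta>1 * lPi) ((1 - \<delta>1) * lmin) + \<delta>1) - 1;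
         U3 = max (1 - 1 / K) (1 / ((1 - \<delta>2) * lPi + \<delta>2) - 1)
     in (\<delta>2 \<le> 1 \<longrightarrow> L1 \<le> normE \<and> normE \<le> U1)
      \<and> (\<delta>1 \<le> 1 \<and> 1 < \<delta>2 \<and> ereal \<delta>2 < quot_pred lPi
           \<longrightarrow> L2 \<le> normE \<and> normE \<le> max U1 U2)
      \<and> (1 < \<delta>1 \<and> \<delta>1 \<le> \<delta>2 \<and> ereal \<delta>2 < quot_pred lPi
           \<longrightarrow> max L2 L3 \<le> normE \<and> normE \<le> U3)"
proof -
  define N where "N = Mtilde A M"
  define Mc where "Mc = transpose P ** N ** P"
  define Kc where "Kc = Mc + Bc - coarse A P"
  define X where "X = mat 1 - transpose (matrix_inv M) ** A"
  define Y where "Y = mat 1 - matrix_inv M ** A"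
  define \<Theta> where "\<Theta> = P ** matrix_inv Bc ** transpose P ** A"
  define Q where "Q = P ** matrix_inv Kc ** transpose P ** N"
  define R where "R = Pi_proj N P"
  define \<delta>\<^sub>1 where "\<delta>\<^sub>1 = d1 A M P Bc"
  define \<delta>\<^sub>2 where "\<delta>\<^sub>2 = d2 A M P Bc"
  define D where "D = Bc - coarse A P"
  note A = assms(1)
  have N: "spd N" unfolding N_def by (rule spd_Mtilde[OF assms(2,3)])
  have AN: "(A *v v) \<bullet> v \<le> (N *v v) \<bullet> v" for v unfolding N_def by (rule A_le_Mtilde[OF A assms(3)])
  have injP: "inj ((*v) P)" using assms(5) by (simp add: full_rank_injective)
  have Mc: "spd Mc" unfolding Mc_def by (rule spd_congruence[OF N injP])
  have Pt: "(transpose P *v x) \<bullet> y = (P *v y) \<bullet> x" for x y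
    using inner_matrix_transpose[of P y x] by (simp add: inner_commute)
  have coarse_vec: "coarse H P *v x = transpose P *v (H *v (P *v x))" for H x
    by (simp add: coarse_def matrix_vector_mul_assoc matrix_mul_assoc)
  have Mc_coarse: "Mc = coarse N P" by (simp add: Mc_def coarse_def)
  have coarse_quad: "(coarse H P *v x) \<bullet> x = (H *v (P *v x)) \<bullet> (P *v x)" for H x
    using Pt[of "H *v (P *v x)" x] by (simp add: coarse_vec inner_commute)
  have D_sym: "transpose D = D"
    using spd_sym[OF A] spd_sym[OF assms(6)]
    by (simp add: D_def coarse_def transpose_diff matrix_transpose_mul matrix_mul_assoc)
  have Kc_D: "Kc = Mc + D" by (simp add: Kc_def D_def)
  \<comment> \<open>The form of Kc at v is that of Bc at v plus that of N - A at P v.\<close>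
  have "(Kc *v v) \<bullet> v > 0" if "v \<noteq> 0" for v
    using spd_pos[OF assms(6) that] AN[of "P *v v"]
    by (simp add: Kc_def Mc_coarse matrix_vector_mult_diff_rdistrib matrix_vector_mult_add_rdistrib
        inner_simps coarse_quad)
  then have Kc: "spd Kc"
    using spd_sym[OF Mc] D_sym by (simp add: spd_def Kc_D transpose_add)
  define \<mu>\<^sub>1 where "\<mu>\<^sub>1 = lambda_max (matrix_inv Mc ** D)"
  define \<mu>\<^sub>2 where "\<mu>\<^sub>2 = lambda_min (matrix_inv Mc ** D)"
  obtain a where a: "a \<noteq> 0" "D *v a = \<mu>\<^sub>1 *\<^sub>R (Mc *v a)"
    and max: "\<And>x. (D *v x) \<bullet> x \<le> \<mu>\<^sub>1 * ((Mc *v x) \<bullet> x)"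
    using lambda_max_pencil[OF Mc D_sym] unfolding \<mu>\<^sub>1_def by metis
  obtain b where b: "b \<noteq> 0" "D *v b = \<mu>\<^sub>2 *\<^sub>R (Mc *v b)"
    and min: "\<And>x. \<mu>\<^sub>2 * ((Mc *v x) \<bullet> x) \<le> (D *v x) \<bullet> x"
    using lambda_min_pencil[OF Mc D_sym] unfolding \<mu>\<^sub>2_def by metis
  have Kc_quad: "(Kc *v x) \<bullet> x = (Mc *v x) \<bullet> x + (D *v x) \<bullet> x" for x
    by (simp add: Kc_D matrix_vector_mult_add_rdistrib inner_simps)
  \<comment> \<open>Positivity of Kc = Mc + D at the minimizing eigenvector makes the denominators
    in \<open>d1\<close> and \<open>d2\<close> positive.\<close>
  have "(1 + \<mu>\<^sub>2) * ((Mc *v b) \<bullet> b) > 0"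
    using spd_pos[OF Kc b(1)] by (simp add: Kc_quad b(2) algebra_simps)
  then have l2: "1 + \<mu>\<^sub>2 > 0" using spd_pos[OF Mc b(1)] by (simp add: zero_less_mult_iff)
  have "\<mu>\<^sub>2 * ((Mc *v a) \<bullet> a) \<le> \<mu>\<^sub>1 * ((Mc *v a) \<bullet> a)" using min[of a] by (simp add: a(2))
  then have l12: "\<mu>\<^sub>2 \<le> \<mu>\<^sub>1" using spd_pos[OF Mc a(1)] by simp
  have delta: "\<delta>\<^sub>1 = 1 / (1 + \<mu>\<^sub>1)" "\<delta>\<^sub>2 = 1 / (1 + \<mu>\<^sub>2)"
    by (simp_all add: \<delta>\<^sub>1_def \<delta>\<^sub>2_def d1_def d2_def \<mu>\<^sub>1_def \<mu>\<^sub>2_def Mc_def D_def N_def)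
  have delta_pos: "0 < \<delta>\<^sub>1" "0 < \<delta>\<^sub>2" and delta_le: "\<delta>\<^sub>1 \<le> \<delta>\<^sub>2"
    using l2 l12 by (simp_all add: delta frac_le)
  \<comment> \<open>These two comparisons of Mc with Kc, once inverted by
    \<open>spd_inverse_antimono\<close>, bound Q between multiples of R.\<close>
  have Mc_le: "(Mc *v x) \<bullet> x \<le> \<delta>\<^sub>2 * ((Kc *v x) \<bullet> x)" for x
    using min[of x] l2 by (simp add: delta Kc_quad field_simps)
  have Kc_le: "(Kc *v x) \<bullet> x \<le> inverse \<delta>\<^sub>1 * ((Mc *v x) \<bullet> x)" for x
    using max[of x] by (simp add: delta Kc_quad algebra_simps)
  have Q_vec: "Q *v x = P *v (matrix_inv Kc *v (transpose P *v (N *v x)))" for x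
    by (simp add: Q_def matrix_vector_mul_assoc matrix_mul_assoc)
  have R_vec: "R *v x = P *v (matrix_inv Mc *v (transpose P *v (N *v x)))" for x
    by (simp add: R_def Pi_proj_def Mc_def matrix_vector_mul_assoc matrix_mul_assoc)
  have \<Theta>_vec: "\<Theta> *v x = P *v (matrix_inv Bc *v (transpose P *v (A *v x)))" for x
    by (simp add: \<Theta>_def matrix_vector_mul_assoc matrix_mul_assoc)
  have correction_inner: "(H *v (P *v (Z *v (transpose P *v (H *v x))))) \<bullet> y
      = (Z *v (transpose P *v (H *v x))) \<bullet> (transpose P *v (H *v y))"
    if "transpose H = H" for H :: "real^'n^'n" and Z :: "real^'c^'c" and x y
    using symmetric_inner[OF that, of "P *v (Z *v (transpose P *v (H *v x)))" y]
      Pt[of "H *v y" "Z *v (transpose P *v (H *v x))"] by (simp add: inner_commute)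
  have correction_sym: "(H *v (P *v (matrix_inv Z *v (transpose P *v (H *v x))))) \<bullet> y
      = (H *v (P *v (matrix_inv Z *v (transpose P *v (H *v y))))) \<bullet> x"
    if "spd H" "spd Z" for H :: "real^'n^'n" and Z :: "real^'c^'c" and x y
    unfolding correction_inner[OF spd_sym[OF that(1)]]
    by (rule symmetric_inner[OF spd_inverse_sym[OF that(2)]])
  have RP: "R *v (P *v x) = P *v x" for x
  proof -
    have "transpose P *v (N *v (P *v x)) = Mc *v x" by (simp add: Mc_coarse coarse_vec)
    then show ?thesis by (simp add: R_vec matrix_inv_cancel spd_invertible[OF Mc])
  qed
  interpret inexact_two_grid_bounds A N X Y \<Theta> Q R \<delta>\<^sub>1 \<delta>\<^sub>2
  proof
    show "spd A" "spd N" by (fact A N)+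
    show "(A *v v) \<bullet> v \<le> (N *v v) \<bullet> v" for v by (fact AN)
    show "N *v (Y *v (X *v v)) = N *v v - A *v v" for v
      unfolding N_def X_def Y_def by (rule Mtilde_smoother[OF assms(2,3)])
    show "(A *v (X *v x)) \<bullet> y = (A *v x) \<bullet> (Y *v y)" for x y
    proof -
      have "(A *v (transpose (matrix_inv M) *v (A *v x))) \<bullet> y = (A *v x) \<bullet> (matrix_inv M *v (A *v y))"
        using symmetric_inner[OF spd_sym[OF A], of "transpose (matrix_inv M) *v (A *v x)" y]
          inner_matrix_transpose[of "matrix_inv M" "A *v y" "A *v x"] by (simp add: inner_commute)
      then show ?thesis
        by (simp add: X_def Y_def matrix_vector_mult_diff_rdistrib matrix_vector_mult_diff_distrib
            inner_simps flip: matrix_vector_mul_assoc)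
    qed
    show "(A *v (\<Theta> *v x)) \<bullet> y = (A *v (\<Theta> *v y)) \<bullet> x" for x y
      unfolding \<Theta>_vec by (rule correction_sym[OF A assms(6)])
    show "(N *v (Q *v x)) \<bullet> y = (N *v (Q *v y)) \<bullet> x" for x y
      unfolding Q_vec by (rule correction_sym[OF N Kc])
    show "Q *v (\<Theta> *v w + z) = \<Theta> *v w" if "N *v z = A *v (w - \<Theta> *v w)" for w z
    proof -
      \<comment> \<open>The Woodbury step: P^T N (P b + z) = Mc b + P^T A w - Ac b with P^T A w = Bc
        b, which sums to Kc b.\<close>
      define b where "b = matrix_inv Bc *v (transpose P *v (A *v w))"
      have w: "\<Theta> *v w = P *v b" by (simp add: \<Theta>_vec b_def)
      have "Bc *v b = transpose P *v (A *v w)" by (simp add: b_def matrix_inv_cancel spd_invertible assms(6))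
      then have "transpose P *v (N *v (P *v b + z)) = Kc *v b"
        using that by (simp add: Kc_def Mc_coarse coarse_vec w matrix_vector_right_distrib
            matrix_vector_mult_diff_rdistrib matrix_vector_mult_add_rdistrib matrix_vector_mult_diff_distrib)
      then show ?thesis by (simp add: Q_vec w matrix_inv_cancel spd_invertible[OF Kc])
    qed
    show "R *v (R *v v) = R *v v" for v using RP R_vec by metis
    show "(N *v (R *v x)) \<bullet> y = (N *v (R *v y)) \<bullet> x" for x y
      unfolding R_vec by (rule correction_sym[OF N Mc])
    show "\<exists>z. z \<noteq> 0 \<and> R *v z = z"
      using injP a(1) RP by (metis injD matrix_vector_mult_0_right)
    show "\<exists>z. z \<noteq> 0 \<and> R *v z = 0"
    proof -
      \<comment> \<open>R factors through P, so its rank is below the dimension and its kernel is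
        nontrivial.\<close>
      have "rank R \<le> CARD('c)"
        using rank_mul_le_left[of P "matrix_inv Mc ** transpose P ** N"] assms(5)
        by (simp add: R_def Pi_proj_def Mc_def matrix_mul_assoc)
      then show ?thesis using assms(4) full_rank_injective[of R] matrix_left_invertible_ker[of R]
          matrix_left_invertible_injective[of R] by force
    qed
    show "\<delta>\<^sub>1 * ((N *v (R *v y)) \<bullet> y) \<le> (N *v (Q *v y)) \<bullet> y" for y
      unfolding R_vec Q_vec correction_inner[OF spd_sym[OF N]]
      using spd_inverse_antimono[OF Kc Mc _ Kc_le] delta_pos by (simp add: field_simps)
    show "(N *v (Q *v y)) \<bullet> y \<le> \<delta>\<^sub>2 * ((N *v (R *v y)) \<bullet> y)" for y
      unfolding R_vec Q_vec correction_inner[OF spd_sym[OF N]]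
      using spd_inverse_antimono[OF Mc Kc _ Mc_le] delta_pos by simp
    show "0 < \<delta>\<^sub>1" "0 < \<delta>\<^sub>2" by (fact delta_pos)+
  qed
  have E_eq: "E_ITG A M P Bc = E"
    unfolding E_def by (simp add: E_ITG_def X_def Y_def \<Theta>_def)
  have lR_eq: "lambda_max (matrix_inv A ** N ** R) = lR"
    by (simp add: lR_def matrix_mul_assoc)
  have K_eq: "K_TG A M P = K"
  proof -
    let ?S = "mat 1 - R"
    \<comment> \<open>Because I - R is an N-orthogonal projection, the squared norm in
      \<open>K_TG\<close> is the form of N (I - R), and the supremum becomes a Rayleigh
      quotient.\<close>
    have quad: "(vnorm N (?S *v v))\<^sup>2 / (vnorm A v)\<^sup>2 = ((N *v (?S *v v)) \<bullet> v) / ((A *v v) \<bullet> v)" for v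
      using spd_nonneg[OF A] spd_nonneg[OF N]
        projection_quadratic[OF complement_range complement_idem complement_inner, where \<kappa> = K]
      by (metis complement_idem complement_inner vnorm_def real_sqrt_pow2)
    have "transpose (N ** ?S) = N ** ?S"
      by (rule symmetricI) (use complement_inner in \<open>simp add: matrix_vector_mul_assoc\<close>)
    from lambda_max_pencil[OF A this]
    obtain u where u: "u \<noteq> 0" "N *v (?S *v u) = K *\<^sub>R (A *v u)"
      "\<And>x. (N *v (?S *v x)) \<bullet> x \<le> K * ((A *v x) \<bullet> x)"
      unfolding K_def matrix_vector_mul_assoc by metis
    show ?thesis
      unfolding K_TG_def N_def[symmetric] R_def[symmetric] quad
    proof (rule cSup_eq_maximum)
      have "K = ((N *v (?S *v u)) \<bullet> u) / ((A *v u) \<bullet> u)" using spd_pos[OF A u(1)] by (simp add: u(2))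
      then show "K \<in> (\<lambda>v. ((N *v (?S *v v)) \<bullet> v) / ((A *v v) \<bullet> v)) ` (UNIV - {0})" using u(1) by blast
      fix t assume "t \<in> (\<lambda>v. ((N *v (?S *v v)) \<bullet> v) / ((A *v v) \<bullet> v)) ` (UNIV - {0})"
      then obtain v where "v \<noteq> 0" "t = ((N *v (?S *v v)) \<bullet> v) / ((A *v v) \<bullet> v)" by blast
      then show "t \<le> K" using u(3)[of v] spd_pos[OF A] by (simp add: pos_divide_le_eq)
    qed
  qed
  \<comment> \<open>In case (i), \<open>U1_bound\<close> also asks for
    \<open>\<delta>\<^sub>1 \<le> 1\<close>, which follows from \<open>delta_le\<close>.\<close>
  show ?thesis
    unfolding Let_def E_eq K_eq N_def[symmetric] R_def[symmetric] lR_eq lmax_def[symmetric]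
      lmin_def[symmetric] \<delta>\<^sub>1_def[symmetric] \<delta>\<^sub>2_def[symmetric]
    using L1_bound L2_bound L3_bound U1_bound U1_U2_bound U3_bound quot_pred_bound delta_le by auto
qed

end
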